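(* Let $n$ be even with $n/2$ odd, let $L_n$ be the Laplacian matrix of the path graph $P_n$, let $Z_n:=I_n-\tau L_n$ with $0<\tau<1/2$, and put $p_1^*:=\frac{n+2}{4}$, $p_2^*:=\frac{3n+2}{4}$. For $p_1,p_2\in\{1,\dots,n\}$ and small $\epsilon>0$ let $\lambda_{\min}(\overset{\approx}{L}_{n,\epsilon},p_1,p_2)$ denote the smallest eigenvalue of $\overset{\approx}{L}_{n,\epsilon}:=L_n+\epsilon e_{p_1}e_{p_1}^T+\epsilon e_{p_2}e_{p_2}^T$. Then: (1) Up to second order in $\epsilon$, $\lambda_{\min}(\overset{\approx}{L}_{n,\epsilon},p_1,p_2)$ is maximized over all pairs $p_1,p_2\in\{1,\dots,n\}$ at $p_1=p_1^*$, $p_2=p_2^*$, with \[\max_{p_1,p_2}\lambda_{\min}=\frac{2\epsilon}{n}-\frac{\epsilon^2}{12n^2}(n^2-4)=\frac{2\epsilon}{n}-\frac{\epsilon^2}{4n}\sum_{j=2}^{n}\frac{\{\cos(\pi(j-1)/4)+\cos(3\pi(j-1)/4)\}^2}{\sin^2\!\big(0.5\pi(j-1)/n\big)\sum_{p=1}^{n}\cos^2\!\big(\pi(j-1)(p-0.5)/n\big)}.\] (2) The nodes $p_1^*,p_2^*$ are the two centers ($k=2$) of $P_n$ with respect to each of the three notions MPLSE, MSub-LE and MSup-LE. (3) If $v_3$ is an eigenvector of $L_n$ for its third smallest eigenvalue $\lambda_3$, then for $j\in\{1,\dots,n\}$, $v_3(j)=0$ if and only if $j\in\{p_1^*,p_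2^*\}$.
   Context: $e_p$ denotes the $p$-th column of $I_n$. The Laplacian of the path $P_n$ is the tridiagonal matrix with diagonal $(1,2,\dots,2,1)$ and sub/super-diagonal entries $-1$. For a graph with Laplacian $L_n$ and $Z_n=I_n-\tau L_n$ ($0<\tau<1/\Delta$, $\Delta$ the maximum degree), a subset $S\subset\{1,\dots,n\}$ with $|S|=k<n$, and sufficiently small $\epsilon>0$, set ${}^S\tilde L_n:=L_n-\epsilon\sum_{j\in S}e_je_j^T$, ${}^S\tilde Z_n:=Z_n+\epsilon\sum_{j\in S}e_je_j^T$, and let ${}^S\hat Z$ be the principal submatrix of $Z_n$ obtained by removing the rows and columns indexed by $S$. The $k$-centers are: MPLSE: the $S$ maximizing $\lambda_{\min}({}^S\tilde L_n)$; MSub-LE: the $S$ minimizing $\lambda_{\max}({}^S\hat Z)$; MSup-LE: the $S$ minimizing $\lambda_{\max}({}^S\tilde Z_n)$ (optimizers over all $S$ with $|S|=k$). *)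

theory Defs
  imports
    Complex_Main
    "HOL-Library.Landau_Symbols"
    "Jordan_Normal_Form.Spectral_Radius"
    "Jordan_Normal_Form.DL_Submatrix"
begin

text \<open>Nodes are numbered from 1 to n, while rows and columns of matrices are
  numbered from 0; node p corresponds to index p - 1.\<close>

definition path_laplacian :: "nat \<Rightarrow> real mat" where
  "path_laplacian n = mat n n (\<lambda>(i, j).
     if i = j then (if i = 0 \<or> i = n - 1 then 1 else 2)
     else if i = Suc j \<or> j = Suc i then - 1
     else 0)"

definition Z_mat :: "real \<Rightarrow> real mat \<Rightarrow> real mat" where
  "Z_mat \<tau> L = 1\<^sub>m (dim_row L) - \<tau> \<cdot>\<^sub>m L"

definition e_col :: "nat \<Rightarrow> nat \<Rightarrow> real vec" where
  "e_col n p = col (1\<^sub>m n) (p - 1)"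

definition eeT :: "nat \<Rightarrow> nat \<Rightarrow> real mat" where
  "eeT n p = mat n n (\<lambda>(i, j). e_col n p $ i * e_col n p $ j)"

definition sum_eeT :: "nat \<Rightarrow> nat set \<Rightarrow> real mat" where
  "sum_eeT n S = mat n n (\<lambda>(i, j). \<Sum>p\<in>S. eeT n p $$ (i, j))"

text \<open>These are only used for symmetric matrices of positive dimension,
  whose spectrum over the reals is finite and nonempty.\<close>

definition lambda_min :: "real mat \<Rightarrow> real" where
  "lambda_min A = Min (spectrum A)"

definition lambda_max :: "real mat \<Rightarrow> real" where
  "lambda_max A = Max (spectrum A)"

text \<open>The k-th smallest eigenvalue (k = 1, 2, ...), counted with multiplicity.\<close>

definition kth_smallest_eigenvalue :: "real mat \<Rightarrow> nat \<Rightarrow> real" where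
  "kth_smallest_eigenvalue A k = sorted_list_of_multiset (proots (char_poly A)) ! (k - 1)"

definition L_tilde :: "real mat \<Rightarrow> real \<Rightarrow> nat set \<Rightarrow> real mat" where
  "L_tilde L \<epsilon> S = L - \<epsilon> \<cdot>\<^sub>m sum_eeT (dim_row L) S"

definition Z_tilde :: "real mat \<Rightarrow> real \<Rightarrow> nat set \<Rightarrow> real mat" where
  "Z_tilde Z \<epsilon> S = Z + \<epsilon> \<cdot>\<^sub>m sum_eeT (dim_row Z) S"

definition Z_hat :: "real mat \<Rightarrow> nat set \<Rightarrow> real mat" where
  "Z_hat Z S = submatrix Z {i. i < dim_row Z \<and> Suc i \<notin> S} {i. i < dim_col Z \<and> Suc i \<notin> S}"

definition k_subset :: "nat \<Rightarrow> nat \<Rightarrow> nat set \<Rightarrow> bool" where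
  "k_subset n k S \<longleftrightarrow> S \<subseteq> {1..n} \<and> card S = k"

definition MPLSE_centers :: "real mat \<Rightarrow> nat \<Rightarrow> real \<Rightarrow> nat set \<Rightarrow> bool" where
  "MPLSE_centers L k \<epsilon> S \<longleftrightarrow>
     is_arg_max (\<lambda>S. lambda_min (L_tilde L \<epsilon> S)) (k_subset (dim_row L) k) S"

definition MSub_LE_centers :: "real mat \<Rightarrow> nat \<Rightarrow> nat set \<Rightarrow> bool" where
  "MSub_LE_centers Z k S \<longleftrightarrow>
     is_arg_min (\<lambda>S. lambda_max (Z_hat Z S)) (k_subset (dim_row Z) k) S"

definition MSup_LE_centers :: "real mat \<Rightarrow> nat \<Rightarrow> real \<Rightarrow> nat set \<Rightarrow> bool" where
  "MSup_LE_centers Z k \<epsilon> S \<longleftrightarrow>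
     is_arg_min (\<lambda>S. lambda_max (Z_tilde Z \<epsilon> S)) (k_subset (dim_row Z) k) S"

definition L_two :: "nat \<Rightarrow> real \<Rightarrow> nat \<Rightarrow> nat \<Rightarrow> real mat" where
  "L_two n \<epsilon> p1 p2 = path_laplacian n + \<epsilon> \<cdot>\<^sub>m eeT n p1 + \<epsilon> \<cdot>\<^sub>m eeT n p2"

text \<open>q is the expansion of f up to second order as the argument tends to 0 from above;
  such a q is unique if it exists.\<close>

definition second_order_expansion :: "(real \<Rightarrow> real) \<Rightarrow> real poly \<Rightarrow> bool" where
  "second_order_expansion f q \<longleftrightarrow>
     degree q \<le> 2 \<and> (\<lambda>\<epsilon>. f \<epsilon> - poly q \<epsilon>) \<in> O[at_right 0](\<lambda>\<epsilon>. \<epsilon> ^ 3)"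

end

theory Submission
  imports Defs
begin

text \<open>Write n = 4q + 2. All matrices are tridiagonal with off-diagonal entries -1, and a positive
  vector x with Ax close to \<mu>x entrywise pins down the smallest eigenvalue of such an A from both
  sides. Applied to a second-order approximate eigenvector this shows that the smallest eigenvalue
  of L + t diag b is ts/n - (t^2/n) (sum over k of (B(k) - sk/n)^2) + O(t^3), where B(k) is the sum
  of the first k entries of b and s = B(n). For two marked nodes s = 2 and B is a step function with
  values 0, 1, 2, so the sum is minimised termwise, and uniquely, when B(k) is always the integer
  nearest to 2k/n.
  This settles (1), MPLSE and MSup-LE. For MSub-LE, removing two nodes cuts the path into three
  blocks with explicit eigenvectors; the smallest eigenvalue is governed by the longest block (end
  blocks counting double), and only the pair in question balances all three.\<close>

section \<open>Eigenvalues of matrices with nonpositive off-diagonal entries\<close>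

text \<open>All pairs share the linear coefficient 2/n, so only the quadratic coefficient can
  separate them. It multiplies t^2 and is the same for both signs of t, which is why adding
  \<epsilon> on the diagonal in (1) and subtracting it in MPLSE select the same pair. The two halves
  of an eigenvalue estimate are of different depth. A positive supersolution bounds every eigenvalue
  from below by a maximum argument, whereas a positive subsolution has to produce a real eigenvalue
  below a given number. That existence comes from the intermediate value theorem applied to the
  three-term recurrence, so the tridiagonal form is essential there. MSub-LE is not a perturbation
  problem. Its link to (3) is that the third eigenvector of the path vanishes exactly at the two
  nodes, so that its absolute value survives their removal as a positive eigenvector. For n = 2
  removing two nodes leaves an empty matrix and there is no third eigenvalue, hence the restriction
  to \<open>2 < n\<close> in (2) and (3).\<close>

lemma mult_mat_vec_index_sum:
  assumes "A \<in> carrier_mat n n" "i < n"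
  shows "(A *\<^sub>v vec n f) $ i = (\<Sum>j<n. A $$ (i, j) * f j)"
  using assms by (auto simp: scalar_prod_def lessThan_atLeast0 intro!: sum.cong)

lemma eigenvalueI:
  assumes "A \<in> carrier_mat n n" "i < n" "f i \<noteq> 0"
    and "\<And>i. i < n \<Longrightarrow> (A *\<^sub>v vec n f) $ i = k * f i"
  shows "eigenvalue A k"
proof -
  have "vec n f \<noteq> 0\<^sub>v n" using assms(2,3) by (metis index_vec index_zero_vec(1))
  moreover have "A *\<^sub>v vec n f = k \<cdot>\<^sub>v vec n f"
    using assms by (intro eq_vecI) auto
  ultimately show ?thesis
    unfolding eigenvalue_def eigenvector_def using assms(1) by (intro exI[of _ "vec n f"]) auto
qed

text \<open>Collatz--Wielandt bound: compare an eigenvector with the positive supersolution f at the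
  index where the ratio of their entries is largest.\<close>

lemma eigenvalue_ge_of_supersolution:
  fixes A :: "real mat"
  assumes A: "A \<in> carrier_mat n n"
    and off: "\<And>i j. i < n \<Longrightarrow> j < n \<Longrightarrow> i \<noteq> j \<Longrightarrow> A $$ (i, j) \<le> 0"
    and pos: "\<And>i. i < n \<Longrightarrow> 0 < f i"
    and super: "\<And>i. i < n \<Longrightarrow> \<mu> * f i \<le> (A *\<^sub>v vec n f) $ i"
    and ev: "eigenvalue A k"
  shows "\<mu> \<le> k"
proof -
  obtain v where v: "v \<in> carrier_vec n" "v \<noteq> 0\<^sub>v n" "A *\<^sub>v v = k \<cdot>\<^sub>v v"
    using ev A unfolding eigenvalue_def eigenvector_def by auto
  obtain i0 where i0: "i0 < n" "v $ i0 \<noteq> 0"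
    using v(1,2) by (metis carrier_vecD eq_vecI index_zero_vec)
  have vv: "v = vec n (\<lambda>j. v $ j)" using v(1) by auto
  define r where "r = Max ((\<lambda>j. \<bar>v $ j\<bar> / f j) ` {..<n})"
  have "r \<in> (\<lambda>j. \<bar>v $ j\<bar> / f j) ` {..<n}"
    unfolding r_def using i0 by (intro Max_in) auto
  then obtain i where i: "i < n" "r = \<bar>v $ i\<bar> / f i" by auto
  have le: "\<bar>v $ j\<bar> \<le> r * f j" if "j < n" for j
  proof -
    have "\<bar>v $ j\<bar> / f j \<le> r" unfolding r_def using that by (intro Max_ge) auto
    then show ?thesis using pos[OF that] by (simp add: field_simps)
  qed
  have "0 < r * f i0" using le[OF i0(1)] i0(2) by linarith
  then have r: "0 < r" using pos[OF i0(1)] by (simp add: zero_less_mult_iff)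
  have ri: "r * f i = \<bar>v $ i\<bar>" using i pos[OF i(1)] by simp
  have "\<mu> * (r * f i) \<le> r * (A *\<^sub>v vec n f) $ i"
    using mult_left_mono[OF super[OF i(1)], of r] r by (simp add: ac_simps)
  also have "\<dots> = (\<Sum>j<n. A $$ (i, j) * (r * f j))"
    by (simp add: mult_mat_vec_index_sum[OF A i(1)] sum_distrib_left ac_simps)
  \<comment> \<open>The term j = i is unchanged by the choice of i. In every other term the vector
    entry decreases and its coefficient is nonpositive, so the product increases.\<close>
  also have "\<dots> \<le> (\<Sum>j<n. A $$ (i, j) * (sgn (v $ i) * v $ j))"
  proof (rule sum_mono)
    fix j assume j: "j \<in> {..<n}"
    show "A $$ (i, j) * (r * f j) \<le> A $$ (i, j) * (sgn (v $ i) * v $ j)"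
    proof (cases "i = j")
      case True
      then show ?thesis using ri by (simp add: abs_sgn mult.commute)
    next
      case False
      have "sgn (v $ i) * v $ j \<le> \<bar>v $ j\<bar>" by (auto simp: sgn_if)
      also have "\<dots> \<le> r * f j" using le j by auto
      finally show ?thesis using off[OF i(1) _ False] j by (intro mult_left_mono_neg) auto
    qed
  qed
  also have "\<dots> = sgn (v $ i) * (A *\<^sub>v v) $ i"
    by (subst (3) vv, subst mult_mat_vec_index_sum[OF A i(1)])
       (simp add: sum_distrib_left ac_simps)
  also have "\<dots> = k * (r * f i)"
    using v i(1) unfolding ri by (simp add: abs_sgn)
  finally show ?thesis using r pos[OF i(1)] by simp
qed

lemma lambda_min_le:
  assumes "A \<in> carrier_mat n n" "eigenvalue A k"
  shows "lambda_min A \<le> k"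
  unfolding lambda_min_def using card_finite_spectrum(1)[OF assms(1)] assms(2)
  by (intro Min_le) (auto simp: spectrum_def)

text \<open>The eigenvalue \<open>k\<close> is a witness that the spectrum is nonempty, without
  which \<open>Min\<close> says nothing.\<close>

lemma lambda_min_ge:
  assumes "A \<in> carrier_mat n n" "eigenvalue A k" "\<And>k. eigenvalue A k \<Longrightarrow> \<mu> \<le> k"
  shows "\<mu> \<le> lambda_min A"
  unfolding lambda_min_def using card_finite_spectrum(1)[OF assms(1)] assms(2,3)
  by (subst Min_ge_iff) (auto simp: spectrum_def)

lemma eigenvalue_one_minus_smult:
  fixes A :: "real mat"
  assumes A: "A \<in> carrier_mat n n" and "\<tau> \<noteq> 0"
  shows "eigenvalue (1\<^sub>m n - \<tau> \<cdot>\<^sub>m A) (1 - \<tau> * k) \<longleftrightarrow> eigenvalue A k"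
proof -
  have "(1\<^sub>m n - \<tau> \<cdot>\<^sub>m A) *\<^sub>v v = (1 - \<tau> * k) \<cdot>\<^sub>v v \<longleftrightarrow> A *\<^sub>v v = k \<cdot>\<^sub>v v"
    if v: "v \<in> carrier_vec n" for v
  proof -
    have "(1\<^sub>m n - \<tau> \<cdot>\<^sub>m A) *\<^sub>v v = v - \<tau> \<cdot>\<^sub>v (A *\<^sub>v v)"
      using A v by (subst minus_mult_distrib_mat_vec[of _ n n]) auto
    moreover have "dim_vec v = n" "dim_row A = n" using A v by auto
    ultimately show ?thesis
      using \<open>\<tau> \<noteq> 0\<close> by (simp add: vec_eq_iff left_diff_distrib del: index_mult_mat_vec)
  qed
  then show ?thesis
    unfolding eigenvalue_def eigenvector_def using A by auto
qed

text \<open>The map x to 1 - \<tau> x is decreasing and carries one spectrum onto the other. This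
  turns the minimization of \<open>lambda_max\<close> in MSub-LE and MSup-LE into a maximization of
  \<open>lambda_min\<close>.\<close>

lemma lambda_max_one_minus_smult:
  fixes A :: "real mat"
  assumes A: "A \<in> carrier_mat n n" and "0 < \<tau>" and "eigenvalue A k"
  shows "lambda_max (1\<^sub>m n - \<tau> \<cdot>\<^sub>m A) = 1 - \<tau> * lambda_min A"
proof -
  let ?h = "\<lambda>x. 1 - \<tau> * x"
  have ev: "eigenvalue (1\<^sub>m n - \<tau> \<cdot>\<^sub>m A) (?h x) \<longleftrightarrow> eigenvalue A x" for x
    using eigenvalue_one_minus_smult[OF A] \<open>0 < \<tau>\<close> by simp
  have "spectrum (1\<^sub>m n - \<tau> \<cdot>\<^sub>m A) = ?h ` spectrum A"
  proof (intro equalityI subsetI)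
    fix y assume "y \<in> spectrum (1\<^sub>m n - \<tau> \<cdot>\<^sub>m A)"
    moreover have "y = ?h ((1 - y) / \<tau>)" using \<open>0 < \<tau>\<close> by simp
    ultimately show "y \<in> ?h ` spectrum A"
      unfolding spectrum_def using ev[of "(1 - y) / \<tau>"] by (metis image_eqI mem_Collect_eq)
  qed (auto simp: spectrum_def ev)
  moreover have "finite (spectrum A)" using card_finite_spectrum(1)[OF A] .
  moreover have "spectrum A \<noteq> {}" using assms(3) by (auto simp: spectrum_def)
  ultimately show ?thesis
    unfolding lambda_max_def lambda_min_def using \<open>0 < \<tau>\<close>
    by (intro Max_eqI) (auto intro: mult_left_mono)
qed

section \<open>Principal submatrices, tested with vectors supported on the kept indices\<close>

lemma sum_pick:
  assumes "finite I"
  shows "(\<Sum>k<card I. g (pick I k)) = sum g I"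
proof (rule sum.reindex_bij_betw)
  have inj: "inj_on (pick I) {..<card I}"
    by (rule linorder_inj_onI) (auto dest: pick_mono_le)
  have "pick I ` {..<card I} \<subseteq> I" using pick_in_set_le by auto
  moreover have "card (pick I ` {..<card I}) = card I" using inj by (simp add: card_image)
  ultimately have "pick I ` {..<card I} = I" using assms by (simp add: card_subset_eq)
  with inj show "bij_betw (pick I) {..<card I} I" by (simp add: bij_betw_def)
qed

lemma submatrix_carrier:
  assumes "A \<in> carrier_mat n n" "I \<subseteq> {..<n}"
  shows "submatrix A I I \<in> carrier_mat (card I) (card I)"
proof -
  have "{i. i < n \<and> i \<in> I} = I" using assms(2) by auto
  then show ?thesis using assms(1) by (auto simp: submatrix_def)
qed

text \<open>The dropped columns meet only zeros of f. Functions on all n indices can therefore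
  replace vectors renumbered by \<open>pick\<close>.\<close>

lemma submatrix_mult_vec_supported:
  fixes A :: "real mat"
  assumes A: "A \<in> carrier_mat n n" and I: "I \<subseteq> {..<n}"
    and supp: "\<And>i. i < n \<Longrightarrow> i \<notin> I \<Longrightarrow> f i = 0"
    and k: "k < card I"
  shows "(submatrix A I I *\<^sub>v vec (card I) (\<lambda>k. f (pick I k))) $ k = (A *\<^sub>v vec n f) $ (pick I k)"
proof -
  have eq: "{i. i < n \<and> i \<in> I} = I" using I by auto
  have p: "pick I k < n" using pick_in_set_le[OF k] I by auto
  have dims: "dim_row A = n" "dim_col A = n" using A by auto
  have "(submatrix A I I *\<^sub>v vec (card I) (\<lambda>k. f (pick I k))) $ k
      = (\<Sum>j<card I. A $$ (pick I k, pick I j) * f (pick I j))"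
    unfolding mult_mat_vec_index_sum[OF submatrix_carrier[OF A I] k]
    using k eq dims by (intro sum.cong) (auto simp: submatrix_index)
  also have "\<dots> = (\<Sum>j\<in>I. A $$ (pick I k, j) * f j)"
    using finite_subset[OF I] by (intro sum_pick) simp
  also have "\<dots> = (\<Sum>j<n. A $$ (pick I k, j) * f j)"
    using I supp by (intro sum.mono_neutral_left) auto
  finally show ?thesis using mult_mat_vec_index_sum[OF A p] by simp
qed

text \<open>The eigenvalue equation is asked for on \<open>I\<close> alone. It may fail in a removed
  row, so a function with a kink at a removed node is admissible.\<close>

lemma eigenvalue_submatrixI:
  fixes A :: "real mat"
  assumes A: "A \<in> carrier_mat n n" and I: "I \<subseteq> {..<n}"
    and supp: "\<And>i. i < n \<Longrightarrow> i \<notin> I \<Longrightarrow> f i = 0"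
    and nz: "i \<in> I" "f i \<noteq> 0"
    and ev: "\<And>i. i \<in> I \<Longrightarrow> (A *\<^sub>v vec n f) $ i = \<mu> * f i"
  shows "eigenvalue (submatrix A I I) \<mu>"
proof (rule eigenvalueI[OF submatrix_carrier[OF A I]])
  have "finite I" using I finite_subset by blast
  \<comment> \<open>The rank of i within \<open>I\<close> is the row that \<open>pick I\<close> maps
    to i.\<close>
  then have "card {a \<in> I. a < i} < card I" using nz(1) by (intro psubset_card_mono) auto
  then show "card {a \<in> I. a < i} < card I" .
  show "f (pick I (card {a \<in> I. a < i})) \<noteq> 0" using nz by (simp add: pick_card_in_set)
  fix k assume "k < card I"
  then show "(submatrix A I I *\<^sub>v vec (card I) (\<lambda>k. f (pick I k))) $ k = \<mu> * f (pick I k)"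
    using submatrix_mult_vec_supported[OF A I, of f k] supp ev pick_in_set_le
    by (simp del: index_mult_mat_vec)
qed

lemma eigenvalue_submatrix_ge_of_supersolution:
  fixes A :: "real mat"
  assumes A: "A \<in> carrier_mat n n" and I: "I \<subseteq> {..<n}"
    and off: "\<And>i j. i < n \<Longrightarrow> j < n \<Longrightarrow> i \<noteq> j \<Longrightarrow> A $$ (i, j) \<le> 0"
    and supp: "\<And>i. i < n \<Longrightarrow> i \<notin> I \<Longrightarrow> f i = 0"
    and pos: "\<And>i. i \<in> I \<Longrightarrow> 0 < f i"
    and super: "\<And>i. i \<in> I \<Longrightarrow> \<mu> * f i \<le> (A *\<^sub>v vec n f) $ i"
    and ev: "eigenvalue (submatrix A I I) k"
  shows "\<mu> \<le> k"
proof (rule eigenvalue_ge_of_supersolution[OF submatrix_carrier[OF A I] _ _ _ ev,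
    where f = "\<lambda>k. f (pick I k)"])
  have eq: "{i. i < n \<and> i \<in> I} = I" using I by auto
  have dims: "dim_row A = n" "dim_col A = n" using A by auto
  fix a b assume ab: "a < card I" "b < card I" "a \<noteq> b"
  have "pick I a \<noteq> pick I b" using ab pick_mono_le by (metis nat_neq_iff)
  moreover have "pick I a < n" "pick I b < n" using ab pick_in_set_le I by auto
  ultimately show "submatrix A I I $$ (a, b) \<le> 0"
    using ab off eq dims by (simp add: submatrix_index)
next
  fix a assume a: "a < card I"
  then show "0 < f (pick I a)" using pos pick_in_set_le by blast
  show "\<mu> * f (pick I a) \<le> (submatrix A I I *\<^sub>v vec (card I) (\<lambda>k. f (pick I k))) $ a"
    using submatrix_mult_vec_supported[OF A I, of f a] supp a super pick_in_set_le[OF a]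
    by (simp del: index_mult_mat_vec)
qed

section \<open>Tridiagonal matrices of a path\<close>

text \<open>The diagonal is left free so that the Laplacian and its diagonal perturbations belong to
  one family, to which the recurrence argument applies uniformly.\<close>

definition path_jacobi :: "nat \<Rightarrow> (nat \<Rightarrow> real) \<Rightarrow> real mat" where
  "path_jacobi n d = mat n n (\<lambda>(i, j). if i = j then d i
     else if i = Suc j \<or> j = Suc i then - 1 else 0)"

lemma path_jacobi_carrier [simp]: "path_jacobi n d \<in> carrier_mat n n"
  by (simp add: path_jacobi_def)

lemma path_jacobi_off_diag:
  "i < n \<Longrightarrow> j < n \<Longrightarrow> i \<noteq> j \<Longrightarrow> path_jacobi n d $$ (i, j) \<le> 0"
  by (simp add: path_jacobi_def)

lemma path_jacobi_sym:
  "i < n \<Longrightarrow> j < n \<Longrightarrow> path_jacobi n d $$ (i, j) = path_jacobi n d $$ (j, i)"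
  by (auto simp: path_jacobi_def)

lemma path_jacobi_mult_vec:
  assumes i: "i < n"
  shows "(path_jacobi n d *\<^sub>v vec n f) $ i =
    d i * f i - (if i = 0 then 0 else f (i - 1)) - (if Suc i < n then f (Suc i) else 0)"
proof -
  have "(path_jacobi n d *\<^sub>v vec n f) $ i = (\<Sum>j<n. path_jacobi n d $$ (i, j) * f j)"
    by (rule mult_mat_vec_index_sum) (use i in auto)
  also have "\<dots> = (\<Sum>j<n. (if j = i then d i * f i else 0)
      + (if Suc j = i then - f j else 0) + (if j = Suc i then - f j else 0))"
    using i by (intro sum.cong) (auto simp: path_jacobi_def)
  also have "\<dots> = d i * f i + (\<Sum>j<n. if Suc j = i then - f j else 0)
      + (if Suc i < n then - f (Suc i) else 0)"
    using i by (simp add: sum.distrib)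
  also have "(\<Sum>j<n. if Suc j = i then - f j else 0) = (if i = 0 then 0 else - f (i - 1))"
  proof (cases i)
    case (Suc m)
    then show ?thesis using i by (simp add: sum.delta)
  qed simp
  finally show ?thesis by simp
qed

lemma path_jacobi_mult_symmetric:
  "(\<Sum>i<n. g i * (path_jacobi n d *\<^sub>v vec n f) $ i) = (\<Sum>i<n. f i * (path_jacobi n d *\<^sub>v vec n g) $ i)"
proof -
  have "(\<Sum>i<n. g i * (path_jacobi n d *\<^sub>v vec n f) $ i)
      = (\<Sum>i<n. \<Sum>j<n. g i * path_jacobi n d $$ (i, j) * f j)"
    by (auto simp: mult_mat_vec_index_sum[OF path_jacobi_carrier] sum_distrib_left ac_simps
        simp del: index_mult_mat_vec intro!: sum.cong)
  also have "\<dots> = (\<Sum>j<n. \<Sum>i<n. f j * (path_jacobi n d $$ (j, i) * g i))"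
    by (subst sum.swap) (auto simp: ac_simps path_jacobi_sym intro!: sum.cong)
  also have "\<dots> = (\<Sum>i<n. f i * (path_jacobi n d *\<^sub>v vec n g) $ i)"
    by (auto simp: mult_mat_vec_index_sum[OF path_jacobi_carrier] sum_distrib_left
        simp del: index_mult_mat_vec intro!: sum.cong)
  finally show ?thesis .
qed

text \<open>Shooting: the solution of the three-term recurrence of the eigenvalue equation started at
  the left end; it is an eigenvector of the n by n matrix iff its entry n vanishes.\<close>

fun shoot :: "(nat \<Rightarrow> real) \<Rightarrow> real \<Rightarrow> nat \<Rightarrow> real" where
  "shoot d x 0 = 1"
| "shoot d x (Suc 0) = d 0 - x"
| "shoot d x (Suc (Suc k)) = (d (Suc k) - x) * shoot d x (Suc k) - shoot d x k"

lemma isCont_shoot: "isCont (\<lambda>x. shoot d x k) x"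
  by (induction d x k rule: shoot.induct) (auto intro!: continuous_intros)

lemma path_jacobi_mult_shoot:
  assumes "i < n"
  shows "(path_jacobi n d *\<^sub>v vec n (shoot d x)) $ i
    = x * shoot d x i + (if Suc i = n then shoot d x n else 0)"
proof -
  have "shoot d x (Suc i) = (d i - x) * shoot d x i - (if i = 0 then 0 else shoot d x (i - 1))"
    by (cases i) auto
  then show ?thesis using assms
    by (auto simp: path_jacobi_mult_vec algebra_simps simp del: index_mult_mat_vec)
qed

text \<open>If every d(i) - x is at least 2, the recurrence gives s(k+2) \<ge> 2 s(k+1) - s(k), so
  the sequence never decreases from its initial value 1. The induction has to carry this
  monotonicity along with positivity.\<close>

lemma shoot_pos_at_bot:
  assumes "\<And>i. i < n \<Longrightarrow> x + 2 \<le> d i" "k \<le> n"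
  shows "0 < shoot d x k"
proof -
  have "k \<le> n \<Longrightarrow> 0 < shoot d x k \<and> (k < n \<longrightarrow> shoot d x k \<le> shoot d x (Suc k))" for k
  proof (induction k)
    case 0
    then show ?case using assms(1)[of 0] by auto
  next
    case (Suc k)
    then have p: "0 < shoot d x k" "shoot d x k \<le> shoot d x (Suc k)" by auto
    have "2 * shoot d x (Suc k) \<le> (d (Suc k) - x) * shoot d x (Suc k)" if "Suc k < n"
      using assms(1)[OF that] p by (intro mult_right_mono) auto
    then have q: "Suc k < n \<Longrightarrow> shoot d x (Suc k) \<le> shoot d x (Suc (Suc k))"
      using p unfolding shoot.simps(3) by linarith
    show ?case using p q by (auto simp del: shoot.simps)
  qed
  then show ?thesis using assms(2) by blast
qed

lemma shoot_root_exists_between: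
  assumes r: "shoot d r k < 0"
  shows "\<exists>s<r. shoot d s k = 0"
proof -
  \<comment> \<open>A point so far to the left that all d(i) - x are at least 2; the inserted 0
    keeps \<open>Min\<close> meaningful for k = 0.\<close>
  define x where "x = min (r - 1) (Min (insert 0 (d ` {..<k})) - 2)"
  have "x + 2 \<le> d i" if "i < k" for i
  proof -
    have "Min (insert 0 (d ` {..<k})) \<le> d i" using that by (intro Min_le) auto
    then show ?thesis by (simp add: x_def)
  qed
  then have "0 < shoot d x k" by (intro shoot_pos_at_bot[where n = k]) auto
  moreover have "x \<le> r" by (simp add: x_def)
  ultimately obtain s where "s \<le> r" "shoot d s k = 0"
    using IVT2[of "\<lambda>x. shoot d x k" r 0 x] r isCont_shoot by auto
  then show ?thesis using r by (intro exI[of _ s]) (auto simp: less_le)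
qed

lemma shoot_pos_of_no_root:
  assumes "\<And>s. s \<le> r \<Longrightarrow> shoot d s k \<noteq> 0"
  shows "0 < shoot d r k"
proof (rule ccontr)
  assume "\<not> ?thesis"
  then have "shoot d r k < 0" using assms[of r] by auto
  then show False using shoot_root_exists_between assms by (metis less_imp_le)
qed

text \<open>No root lies far to the left, where the entry is positive, and the roots form a closed
  set by continuity. Those between the two bounds form a compact nonempty set, which attains its
  infimum.\<close>

lemma shoot_least_root:
  assumes r: "shoot d r k = 0"
  shows "\<exists>s\<le>r. shoot d s k = 0 \<and> (\<forall>t<s. shoot d t k \<noteq> 0)"
proof -
  define x where "x = min r (Min (insert 0 (d ` {..<k})) - 2)"
  have no: "shoot d t k \<noteq> 0" if "t \<le> x" for t
  proof -
    have "t + 2 \<le> d i" if "i < k" for i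
    proof -
      have "Min (insert 0 (d ` {..<k})) \<le> d i" using that by (intro Min_le) auto
      then show ?thesis using \<open>t \<le> x\<close> by (simp add: x_def)
    qed
    then have "0 < shoot d t k" by (intro shoot_pos_at_bot[where n = k]) auto
    then show ?thesis by simp
  qed
  let ?R = "{x..r} \<inter> {t. shoot d t k = 0}"
  have "closed {t. shoot d t k = 0}"
    by (intro closed_Collect_eq continuous_at_imp_continuous_on) (auto simp: isCont_shoot)
  then have "compact ?R" by (intro compact_Int_closed) auto
  moreover have "r \<in> ?R" using r by (simp add: x_def)
  ultimately obtain s where s: "s \<in> ?R" "\<forall>t\<in>?R. s \<le> t"
    using compact_attains_inf[of ?R] by (metis empty_iff)
  have "shoot d t k \<noteq> 0" if "t < s" for t
  proof
    assume t: "shoot d t k = 0"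
    then have "x < t" using no[of t] by linarith
    then have "t \<in> ?R" using s(1) that t by auto
    then have "s \<le> t" using s(2) by blast
    then show False using that by simp
  qed
  then show ?thesis using s(1) by (intro exI[of _ s]) auto
qed

text \<open>Interlacing: at the smallest root of entry k + 1, entry k is still positive, so entry k + 2,
  being its negative, has already changed sign.\<close>

lemma shoot_root_Suc:
  assumes "shoot d r k = 0"
  shows "\<exists>s<r. shoot d s (Suc k) = 0"
  using assms
proof (induction k arbitrary: r)
  case 0
  then show ?case by simp
next
  case (Suc k)
  obtain s where s: "s \<le> r" "shoot d s (Suc k) = 0" "\<And>t. t < s \<Longrightarrow> shoot d t (Suc k) \<noteq> 0"
    using shoot_least_root[OF Suc.prems] by auto
  \<comment> \<open>A root of entry k at t would, by induction, yield a root of entry k + 1 strictly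
    to the left of t, contradicting the minimality of s.\<close>
  have "shoot d t k \<noteq> 0" if "t \<le> s" for t
    using Suc.IH[of t] s(3) that by fastforce
  then have "0 < shoot d s k" by (rule shoot_pos_of_no_root)
  then have "shoot d s (Suc (Suc k)) < 0" using s(2) by simp
  then show ?case using shoot_root_exists_between[of d s "Suc (Suc k)"] s(1) by (meson less_le_trans)
qed

lemma shoot_root_mono:
  assumes "shoot d r k = 0" "k \<le> m"
  shows "\<exists>s\<le>r. shoot d s m = 0"
  using assms(2)
proof (induction m rule: dec_induct)
  case base
  then show ?case using assms(1) by auto
next
  case (step m)
  then show ?case using shoot_root_Suc by (meson less_imp_le order_trans)
qed

text \<open>If there were no eigenvalue up to \<mu>, entry n of the recurrence would have no root
  there, and by interlacing neither would any earlier entry; hence all entries are positive at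
  \<mu>. Pairing this positive vector with f and moving the symmetric matrix across, the \<mu> terms
  cancel and leave f(n - 1) times entry n at most 0, although both factors are positive.\<close>

lemma path_jacobi_eigenvalue_le_of_subsolution:
  assumes n: "0 < n" and pos: "\<And>i. i < n \<Longrightarrow> 0 < f i"
    and sub: "\<And>i. i < n \<Longrightarrow> (path_jacobi n d *\<^sub>v vec n f) $ i \<le> \<mu> * f i"
  shows "\<exists>k\<le>\<mu>. eigenvalue (path_jacobi n d) k"
proof -
  have "\<exists>k\<le>\<mu>. shoot d k n = 0"
  proof (rule ccontr)
    assume no: "\<not> ?thesis"
    have p: "0 < shoot d \<mu> k" if "k \<le> n" for k
    proof (rule shoot_pos_of_no_root)
      fix s assume "s \<le> \<mu>"
      then show "shoot d s k \<noteq> 0" using no shoot_root_mono[OF _ that] by (meson order_trans)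
    qed
    have "(\<Sum>i<n. shoot d \<mu> i * (path_jacobi n d *\<^sub>v vec n f) $ i)
        \<le> (\<Sum>i<n. shoot d \<mu> i * (\<mu> * f i))"
      using sub p by (intro sum_mono mult_left_mono) (auto intro: less_imp_le simp del: index_mult_mat_vec)
    moreover have "(\<Sum>i<n. shoot d \<mu> i * (path_jacobi n d *\<^sub>v vec n f) $ i)
        = (\<Sum>i<n. f i * (\<mu> * shoot d \<mu> i + (if Suc i = n then shoot d \<mu> n else 0)))"
      unfolding path_jacobi_mult_symmetric[of "shoot d \<mu>"]
      by (simp add: path_jacobi_mult_shoot del: index_mult_mat_vec)
    moreover have "\<dots> = (\<Sum>i<n. shoot d \<mu> i * (\<mu> * f i)) + f (n - 1) * shoot d \<mu> n"
    proof -
      have "(\<Sum>i<n. f i * (\<mu> * shoot d \<mu> i + (if Suc i = n then shoot d \<mu> n else 0)))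
        = (\<Sum>i<n. shoot d \<mu> i * (\<mu> * f i) + (if i = n - 1 then f (n - 1) * shoot d \<mu> n else 0))"
        using n by (intro sum.cong) (auto simp: algebra_simps)
      then show ?thesis using n by (simp add: sum.distrib)
    qed
    ultimately show False using mult_pos_pos[OF pos[of "n - 1"] p[of n]] n by auto
  qed
  then obtain k where k: "k \<le> \<mu>" "shoot d k n = 0" by auto
  have "eigenvalue (path_jacobi n d) k"
    by (rule eigenvalueI[where f = "shoot d k" and i = 0 and n = n])
       (use n k in \<open>auto simp: path_jacobi_mult_shoot simp del: index_mult_mat_vec\<close>)
  then show ?thesis using k(1) by blast
qed

text \<open>The constant vector is a subsolution for large \<mu>, because the off-diagonal entries
  only lower the row sums.\<close>

lemma path_jacobi_eigenvalue_exists: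
  assumes "0 < n"
  shows "\<exists>k. eigenvalue (path_jacobi n d) k"
proof -
  have "(path_jacobi n d *\<^sub>v vec n (\<lambda>_. 1)) $ i \<le> (\<Sum>j<n. \<bar>d j\<bar>) * 1" if "i < n" for i
  proof -
    have "d i \<le> \<bar>d i\<bar>" by simp
    also have "\<dots> \<le> (\<Sum>j<n. \<bar>d j\<bar>)" using that by (intro member_le_sum) auto
    finally show ?thesis unfolding path_jacobi_mult_vec[OF that] by auto
  qed
  then show ?thesis
    using path_jacobi_eigenvalue_le_of_subsolution[where f = "\<lambda>_. 1", OF assms] by fastforce
qed

text \<open>The lower bound c on the entries turns the absolute residual into one of at most \<eta>
  f(i). Thus f is a subsolution for \<mu> + \<eta> and a supersolution for \<mu> - \<eta>.\<close>

lemma path_jacobi_lambda_min_bounds: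
  assumes n: "0 < n" and c: "0 < c" "\<And>i. i < n \<Longrightarrow> c \<le> f i"
    and res: "\<And>i. i < n \<Longrightarrow> \<bar>(path_jacobi n d *\<^sub>v vec n f) $ i - \<mu> * f i\<bar> \<le> c * \<eta>"
  shows "\<bar>lambda_min (path_jacobi n d) - \<mu>\<bar> \<le> \<eta>"
proof -
  let ?A = "path_jacobi n d"
  have pos: "0 < f i" if "i < n" for i using c that by force
  have "0 \<le> c * \<eta>" using res[OF n] by linarith
  then have \<eta>: "0 \<le> \<eta>" using c(1) by (simp add: zero_le_mult_iff)
  have b: "c * \<eta> \<le> \<eta> * f i" if "i < n" for i
    using mult_right_mono[OF c(2)[OF that] \<eta>] by (simp add: mult.commute)
  have "(?A *\<^sub>v vec n f) $ i \<le> (\<mu> + \<eta>) * f i" if "i < n" for i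
    using res[OF that] b[OF that] by (simp add: distrib_right abs_le_iff del: index_mult_mat_vec)
  then obtain k where k: "k \<le> \<mu> + \<eta>" "eigenvalue ?A k"
    using path_jacobi_eigenvalue_le_of_subsolution[where f = f, OF n pos] by blast
  have "\<mu> - \<eta> \<le> k'" if "eigenvalue ?A k'" for k'
  proof (rule eigenvalue_ge_of_supersolution[OF path_jacobi_carrier path_jacobi_off_diag pos _ that])
    fix i assume "i < n"
    then show "(\<mu> - \<eta>) * f i \<le> (?A *\<^sub>v vec n f) $ i"
      using res[of i] b[of i] by (simp add: left_diff_distrib abs_le_iff del: index_mult_mat_vec)
  qed auto
  then have "\<mu> - \<eta> \<le> lambda_min ?A" by (rule lambda_min_ge[OF path_jacobi_carrier k(2)])
  moreover have "lambda_min ?A \<le> \<mu> + \<eta>" using lambda_min_le[OF path_jacobi_carrier k(2)] k(1) by simp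
  ultimately show ?thesis by linarith
qed

section \<open>Second-order perturbation of the path Laplacian\<close>

definition path_degree :: "nat \<Rightarrow> nat \<Rightarrow> real" where
  "path_degree n i = (if i = 0 \<or> i = n - 1 then 1 else 2)"

lemma path_laplacian_eq_jacobi: "path_laplacian n = path_jacobi n (path_degree n)"
  unfolding path_laplacian_def path_jacobi_def path_degree_def by (intro cong_mat) auto

lemma path_laplacian_carrier [simp]: "path_laplacian n \<in> carrier_mat n n"
  by (simp add: path_laplacian_eq_jacobi)

lemma path_laplacian_dim [simp]:
  "dim_row (path_laplacian n) = n" "dim_col (path_laplacian n) = n"
  by (simp_all add: path_laplacian_def)

lemma path_laplacian_off_diag:
  "i < n \<Longrightarrow> j < n \<Longrightarrow> i \<noteq> j \<Longrightarrow> path_laplacian n $$ (i, j) \<le> 0"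
  by (simp add: path_laplacian_eq_jacobi path_jacobi_off_diag)

text \<open>Difference form, one term per incident edge. For n = 1 the matrix has the entry 1 where
  the degree is 0, so n starts at 2.\<close>

lemma path_laplacian_mult_vec:
  assumes "2 \<le> n" "i < n"
  shows "(path_laplacian n *\<^sub>v vec n f) $ i =
    (if i = 0 then 0 else f i - f (i - 1)) + (if Suc i < n then f i - f (Suc i) else 0)"
  using assms unfolding path_laplacian_eq_jacobi
  by (auto simp: path_jacobi_mult_vec path_degree_def simp del: index_mult_mat_vec)

text \<open>The solution y of L y = g with y(0) = 0, for g of zero sum: the drop of y across an edge
  is the total of g to the left of that edge. The zero sum is what makes the equation hold at the
  right end.\<close>

definition path_poisson :: "(nat \<Rightarrow> real) \<Rightarrow> nat \<Rightarrow> real" where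
  "path_poisson g k = - (\<Sum>m<k. \<Sum>i\<le>m. g i)"

lemma path_poisson_Suc: "path_poisson g (Suc k) = path_poisson g k - (\<Sum>i\<le>k. g i)"
  by (simp add: path_poisson_def)

lemma path_laplacian_mult_poisson:
  assumes n: "2 \<le> n" and g: "(\<Sum>i<n. g i) = 0" and i: "i < n"
  shows "(path_laplacian n *\<^sub>v vec n (path_poisson g)) $ i = g i"
proof -
  have l: "(if i = 0 then 0 else path_poisson g i - path_poisson g (i - 1)) = - (\<Sum>j<i. g j)"
    by (cases i) (auto simp: path_poisson_Suc lessThan_Suc_atMost)
  have r: "(if Suc i < n then path_poisson g i - path_poisson g (Suc i) else 0) = (\<Sum>j<Suc i. g j)"
  proof (cases "Suc i < n")
    case False
    then have "n = Suc i" using i by simp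
    then show ?thesis using g by simp
  qed (simp add: path_poisson_Suc lessThan_Suc_atMost)
  show ?thesis unfolding path_laplacian_mult_vec[OF n i] l r by simp
qed

text \<open>Summation by parts; the boundary term contains the total of g and vanishes. This is the
  origin of the sum of squares in the second-order coefficient, which perturbation theory first
  delivers as the product of g with the solution of L y = g.\<close>

lemma path_poisson_energy:
  assumes g: "(\<Sum>i<n. g i) = 0"
  shows "(\<Sum>i<n. g i * path_poisson g i) = (\<Sum>k=1..n. (\<Sum>i<k. g i)\<^sup>2)"
proof -
  have "(\<Sum>i<m. g i * path_poisson g i) = (\<Sum>i<m. g i) * path_poisson g m + (\<Sum>k=1..m. (\<Sum>i<k. g i)\<^sup>2)" for m
    by (induction m) (auto simp: path_poisson_Suc lessThan_Suc_atMost[symmetric] power2_eq_square algebra_simps)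
  then show ?thesis using g by simp
qed

text \<open>The second-order approximate eigenvector is 1 - t y + t^2 z, where y and z solve Poisson
  equations on the path; its residual is of order t^3.\<close>

lemma lambda_min_perturbed_path_laplacian:
  fixes b :: "nat \<Rightarrow> real"
  assumes n: "2 \<le> n"
  defines "m \<equiv> (\<Sum>i<n. b i) / real n"
  defines "c \<equiv> - (\<Sum>k=1..n. ((\<Sum>i<k. b i) - m * real k)\<^sup>2) / real n"
  shows "\<exists>C h. 0 < h \<and> (\<forall>t. \<bar>t\<bar> \<le> h \<longrightarrow>
    \<bar>lambda_min (path_jacobi n (\<lambda>i. path_degree n i + t * b i)) - (m * t + c * t\<^sup>2)\<bar> \<le> C * \<bar>t\<bar> ^ 3)"
proof -
  define g where "g i = b i - m" for i
  define y where "y = path_poisson g"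
  \<comment> \<open>Order t of the eigenvalue equation reads L y = b - m and order t^2 reads L z = g
    y + c. Each is solvable only if its right side sums to zero, which forces the values of m and
    c.\<close>
  define g2 where "g2 i = g i * y i + c" for i
  define z where "z = path_poisson g2"
  have g0: "(\<Sum>i<n. g i) = 0" using n by (simp add: g_def sum_subtractf m_def)
  have gk: "(\<Sum>i<k. g i) = (\<Sum>i<k. b i) - m * real k" for k
    by (simp add: g_def sum_subtractf)
  have "(\<Sum>i<n. g i * y i) = - real n * c"
    unfolding y_def path_poisson_energy[OF g0] gk c_def using n by simp
  then have g20: "(\<Sum>i<n. g2 i) = 0" by (simp add: g2_def sum.distrib)
  have Ly: "(path_laplacian n *\<^sub>v vec n y) $ i = g i" if "i < n" for i
    unfolding y_def by (rule path_laplacian_mult_poisson[OF n g0 that])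
  have Lz: "(path_laplacian n *\<^sub>v vec n z) $ i = g2 i" if "i < n" for i
    unfolding z_def by (rule path_laplacian_mult_poisson[OF n g20 that])
  \<comment> \<open>One constant for two purposes: it bounds the coefficient of t^3 in the residual,
    and |t| \<le> 1/(2K) keeps every entry of the approximate eigenvector above 1/2.\<close>
  define K where "K = 1 + (\<Sum>i<n. \<bar>g i * z i\<bar> + \<bar>c * y i\<bar> + \<bar>c * z i\<bar> + \<bar>y i\<bar> + \<bar>z i\<bar>)"
  have K: "\<bar>g i * z i\<bar> + \<bar>c * y i\<bar> + \<bar>c * z i\<bar> + \<bar>y i\<bar> + \<bar>z i\<bar> \<le> K" if "i < n" for i
  proof -
    have "\<bar>g i * z i\<bar> + \<bar>c * y i\<bar> + \<bar>c * z i\<bar> + \<bar>y i\<bar> + \<bar>z i\<bar>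
      \<le> (\<Sum>i<n. \<bar>g i * z i\<bar> + \<bar>c * y i\<bar> + \<bar>c * z i\<bar> + \<bar>y i\<bar> + \<bar>z i\<bar>)"
      using that by (intro member_le_sum) auto
    then show ?thesis by (simp add: K_def)
  qed
  have K1: "1 \<le> K" unfolding K_def by (simp add: sum_nonneg)
  have "\<bar>lambda_min (path_jacobi n (\<lambda>i. path_degree n i + t * b i)) - (m * t + c * t\<^sup>2)\<bar>
      \<le> 2 * K * \<bar>t\<bar> ^ 3" if t: "\<bar>t\<bar> \<le> 1 / (2 * K)" for t
  proof (rule path_jacobi_lambda_min_bounds[where c = "1 / 2" and f = "\<lambda>i. 1 - t * y i + t\<^sup>2 * z i"])
    show "0 < n" using n by simp
    have "1 / (2 * K) \<le> 1" using K1 by (simp add: field_simps)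
    then have t1: "\<bar>t\<bar> \<le> 1" using t by linarith
    have tK: "\<bar>t\<bar> * K \<le> 1 / 2" using t K1 by (simp add: field_simps)
    fix i assume i: "i < n"
    have "\<bar>t\<^sup>2 * z i\<bar> \<le> \<bar>t\<bar> * \<bar>z i\<bar>"
      unfolding abs_mult power2_eq_square
      using mult_right_mono[OF t1, of "\<bar>t\<bar>"] by (intro mult_right_mono) auto
    moreover have "\<bar>t * y i\<bar> = \<bar>t\<bar> * \<bar>y i\<bar>" by (rule abs_mult)
    moreover have "\<bar>t\<bar> * (\<bar>y i\<bar> + \<bar>z i\<bar>) \<le> \<bar>t\<bar> * K" using K[OF i] by (intro mult_left_mono) linarith+
    ultimately show "1 / 2 \<le> 1 - t * y i + t\<^sup>2 * z i"
      using tK unfolding distrib_left by linarith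
    let ?f = "\<lambda>i. 1 - t * y i + t\<^sup>2 * z i"
    have "(path_jacobi n (\<lambda>i. path_degree n i + t * b i) *\<^sub>v vec n ?f) $ i
        = (path_laplacian n *\<^sub>v vec n ?f) $ i + t * b i * ?f i"
      unfolding path_laplacian_eq_jacobi path_jacobi_mult_vec[OF i] by (simp add: algebra_simps)
    also have "(path_laplacian n *\<^sub>v vec n ?f) $ i
        = - t * (path_laplacian n *\<^sub>v vec n y) $ i + t\<^sup>2 * (path_laplacian n *\<^sub>v vec n z) $ i"
      unfolding path_laplacian_mult_vec[OF n i] by (simp add: algebra_simps)
    also have "\<dots> = - t * g i + t\<^sup>2 * g2 i" unfolding Ly[OF i] Lz[OF i] ..
    finally have "(path_jacobi n (\<lambda>i. path_degree n i + t * b i) *\<^sub>v vec n ?f) $ i - (m * t + c * t\<^sup>2) * ?f i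
        = t ^ 3 * (g i * z i + c * y i - t * (c * z i))"
      unfolding g2_def g_def by (simp add: algebra_simps power2_eq_square power3_eq_cube)
    moreover have "\<bar>g i * z i + c * y i - t * (c * z i)\<bar> \<le> K"
    proof -
      have "\<bar>t * (c * z i)\<bar> \<le> 1 * \<bar>c * z i\<bar>" unfolding abs_mult[of t] using t1 by (intro mult_right_mono) auto
      then show ?thesis using K[OF i] by linarith
    qed
    ultimately show "\<bar>(path_jacobi n (\<lambda>i. path_degree n i + t * b i) *\<^sub>v vec n ?f) $ i - (m * t + c * t\<^sup>2) * ?f i\<bar>
        \<le> 1 / 2 * (2 * K * \<bar>t\<bar> ^ 3)"
      using mult_left_mono[of "\<bar>g i * z i + c * y i - t * (c * z i)\<bar>" K "\<bar>t\<bar> ^ 3"]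
      by (simp add: abs_mult power_abs ac_simps del: index_mult_mat_vec)
  qed simp
  moreover have "0 < 1 / (2 * K)" using K1 by simp
  ultimately show ?thesis by blast
qed

section \<open>Optimal pairs of nodes\<close>

definition nodes_upto :: "nat \<Rightarrow> nat \<Rightarrow> nat \<Rightarrow> real" where
  "nodes_upto p1 p2 k = of_bool (p1 \<le> k) + of_bool (p2 \<le> k)"

definition pair_energy :: "nat \<Rightarrow> nat \<Rightarrow> nat \<Rightarrow> real" where
  "pair_energy n p1 p2 = (\<Sum>k=1..n. (nodes_upto p1 p2 k - 2 * real k / real n)\<^sup>2)"

lemma eeT_index:
  assumes "p \<in> {1..n}" "i < n" "j < n"
  shows "eeT n p $$ (i, j) = of_bool (Suc i = p \<and> i = j)"
  using assms by (auto simp: eeT_def e_col_def)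

lemma L_two_eq_jacobi:
  assumes "p1 \<in> {1..n}" "p2 \<in> {1..n}"
  shows "L_two n t p1 p2
    = path_jacobi n (\<lambda>i. path_degree n i + t * (of_bool (Suc i = p1) + of_bool (Suc i = p2)))"
  unfolding L_two_def path_laplacian_eq_jacobi
  by (rule eq_matI)
     (use assms in \<open>auto simp: path_jacobi_def eeT_index eeT_def[THEN arg_cong[where f = dim_row]]
       eeT_def[THEN arg_cong[where f = dim_col]] algebra_simps\<close>)

lemma sum_of_bool_Suc_eq:
  assumes "1 \<le> p"
  shows "(\<Sum>i<k. of_bool (Suc i = p)) = (of_bool (p \<le> k) :: real)"
  using assms by (induction k) (auto simp: of_bool_def)

text \<open>Both signs of t are covered: (1) uses t = \<epsilon>, the centers use t =
  -\<epsilon>.\<close>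

lemma lambda_min_L_two_expansion:
  assumes n: "2 \<le> n" and p: "p1 \<in> {1..n}" "p2 \<in> {1..n}"
  shows "\<exists>C h. 0 < h \<and> (\<forall>t. \<bar>t\<bar> \<le> h \<longrightarrow>
    \<bar>lambda_min (L_two n t p1 p2) - (2 / real n * t - pair_energy n p1 p2 / real n * t\<^sup>2)\<bar> \<le> C * \<bar>t\<bar> ^ 3)"
proof -
  have B: "(\<Sum>i<k. of_bool (Suc i = p1) + of_bool (Suc i = p2)) = nodes_upto p1 p2 k" for k
    unfolding sum.distrib nodes_upto_def using p by (simp only: sum_of_bool_Suc_eq atLeastAtMost_iff)
  have "nodes_upto p1 p2 n = 2" using p by (simp add: nodes_upto_def)
  then show ?thesis
    using lambda_min_perturbed_path_laplacian[OF n, of "\<lambda>i. of_bool (Suc i = p1) + of_bool (Suc i = p2)"]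
    unfolding B L_two_eq_jacobi[OF p] pair_energy_def by simp
qed

lemma sum_squares_linear:
  "(\<Sum>k=1..m. (a - c * real k)\<^sup>2)
    = real m * a\<^sup>2 - a * c * real m * (real m + 1) + c\<^sup>2 * real m * (real m + 1) * (2 * real m + 1) / 6"
  by (induction m) (auto simp: field_simps power2_eq_square)

lemma pair_energy_optimal_value:
  assumes n: "n = 4 * q + 2"
  shows "pair_energy n (q + 1) (3 * q + 2) = ((real n)\<^sup>2 - 4) / (12 * real n)"
proof -
  define h where "h k = (nodes_upto (q + 1) (3 * q + 2) k - 2 * real k / real n)\<^sup>2" for k
  define c where "c = 2 / real n"
  define P where "P a m = (\<Sum>k=1..m. (a - c * real k)\<^sup>2)" for a m
  \<comment> \<open>The range is cut at the jumps into stretches of length q, 2q + 1 and q + 1, on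
    which the step function is 0, 1 and 2.\<close>
  have "pair_energy n (q + 1) (3 * q + 2) = sum h {1..q + (2 * q + 1) + (q + 1)}"
    unfolding pair_energy_def h_def using n by (intro sum.cong) auto
  also have "\<dots> = sum h {1..q} + sum h {q+1..q + (2 * q + 1)}
      + sum h {q + (2 * q + 1) + 1..q + (2 * q + 1) + (q + 1)}"
    by (subst sum.ub_add_nat, simp, subst sum.ub_add_nat, simp, rule refl)
  also have "sum h {1..q} = P 0 q"
    unfolding P_def by (intro sum.cong) (auto simp: h_def nodes_upto_def c_def)
  also have "sum h {q+1..q + (2 * q + 1)} = P 1 (q + (2 * q + 1)) - P 1 q"
  proof -
    have "sum h {q+1..q + (2 * q + 1)} = (\<Sum>k=q+1..q + (2 * q + 1). (1 - c * real k)\<^sup>2)"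
      by (intro sum.cong) (auto simp: h_def nodes_upto_def c_def)
    then show ?thesis unfolding P_def by (subst sum.ub_add_nat) auto
  qed
  also have "sum h {q + (2 * q + 1) + 1..q + (2 * q + 1) + (q + 1)}
      = P 2 (q + (2 * q + 1) + (q + 1)) - P 2 (q + (2 * q + 1))"
  proof -
    have "sum h {q + (2 * q + 1) + 1..q + (2 * q + 1) + (q + 1)}
        = (\<Sum>k=q + (2 * q + 1) + 1..q + (2 * q + 1) + (q + 1). (2 - c * real k)\<^sup>2)"
      by (intro sum.cong) (auto simp: h_def nodes_upto_def c_def)
    then show ?thesis unfolding P_def by (subst sum.ub_add_nat[of _ "q + (2 * q + 1)"]) auto
  qed
  also have "P 0 q + (P 1 (q + (2 * q + 1)) - P 1 q)
      + (P 2 (q + (2 * q + 1) + (q + 1)) - P 2 (q + (2 * q + 1))) = ((real n)\<^sup>2 - 4) / (12 * real n)"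
  proof -
    \<comment> \<open>With x = n/2 the claim becomes a rational identity in one variable.\<close>
    define x where "x = 2 * real q + 1"
    have "0 < x" by (simp add: x_def)
    have c: "c = 1 / x" by (simp add: c_def n x_def field_simps)
    have q: "real q = (x - 1) / 2" by (simp add: x_def)
    have rn: "real n = 2 * x" by (simp add: n x_def)
    show ?thesis
      unfolding P_def sum_squares_linear rn c of_nat_add of_nat_mult of_nat_numeral of_nat_1 q
      using \<open>0 < x\<close> by (simp add: field_simps power2_eq_square)
  qed
  finally show ?thesis .
qed

text \<open>The optimal pair makes the step function the nearest integer to 2k/n for every k; since
  n = 4q + 2, the number 2k/n is never a half-integer.\<close>

lemma nodes_upto_nearest:
  assumes n: "n = 4 * q + 2" and k: "k \<le> n"
  shows "\<bar>nodes_upto (q + 1) (3 * q + 2) k - 2 * real k / real n\<bar> < 1 / 2"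
proof -
  have rn: "real n = 4 * real q + 2" "0 < real n" using n by auto
  consider "k \<le> q" | "q + 1 \<le> k" "k \<le> 3 * q + 1" | "3 * q + 2 \<le> k" by linarith
  then show ?thesis
  proof cases
    case 1
    then have "real k \<le> real q" by simp
    then show ?thesis using 1 rn by (simp add: nodes_upto_def field_simps)
  next
    case 2
    then have "real q + 1 \<le> real k" "real k \<le> 3 * real q + 1" by linarith+
    then have "1 / 2 < 2 * real k / real n" "2 * real k / real n < 3 / 2"
      using rn by (auto simp: field_simps)
    moreover have "nodes_upto (q + 1) (3 * q + 2) k = 1" using 2 by (simp add: nodes_upto_def)
    ultimately show ?thesis by (simp only:)
  next
    case 3
    then have "3 * real q + 2 \<le> real k" "real k \<le> real n" using k by linarith+
    then have "3 / 2 < 2 * real k / real n" "2 * real k / real n \<le> 2"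
      using rn by (auto simp: field_simps)
    then show ?thesis using 3 by (simp add: nodes_upto_def)
  qed
qed

lemma nearest_square_less:
  fixes u v x :: real
  assumes "\<bar>u - x\<bar> < 1 / 2" "1 \<le> \<bar>u - v\<bar>"
  shows "(u - x)\<^sup>2 < (v - x)\<^sup>2"
proof -
  have "\<bar>u - x\<bar> < \<bar>v - x\<bar>" using assms by linarith
  then show ?thesis using abs_less_iff power2_abs
    by (metis abs_ge_zero power2_abs power_strict_mono zero_less_numeral)
qed

text \<open>Both values are integers.\<close>

lemma nodes_upto_dist: "nodes_upto a b k = nodes_upto p1 p2 k \<or> 1 \<le> \<bar>nodes_upto a b k - nodes_upto p1 p2 k\<bar>"
  by (auto simp: nodes_upto_def of_bool_def)

lemma nodes_upto_determines_pair:
  assumes n: "n = 4 * q + 2" and p: "p1 \<in> {1..n}" "p2 \<in> {1..n}"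
    and eq: "\<And>k. k \<in> {1..n} \<Longrightarrow> nodes_upto (q + 1) (3 * q + 2) k = nodes_upto p1 p2 k"
  shows "{p1, p2} = {q + 1, 3 * q + 2}"
proof -
  \<comment> \<open>The counts just before and at each jump locate both nodes. For q = 0 the
    hypothesis does not reach k = 0, but there both counts are 0 since nodes start at 1.\<close>
  have "nodes_upto (q + 1) (3 * q + 2) q = nodes_upto p1 p2 q"
    using eq[of q] n p by (cases q) (auto simp: nodes_upto_def)
  moreover have "nodes_upto (q + 1) (3 * q + 2) (q + 1) = nodes_upto p1 p2 (q + 1)"
    using n by (intro eq) auto
  moreover have "nodes_upto (q + 1) (3 * q + 2) (3 * q + 1) = nodes_upto p1 p2 (3 * q + 1)"
    using n by (intro eq) auto
  moreover have "nodes_upto (q + 1) (3 * q + 2) (3 * q + 2) = nodes_upto p1 p2 (3 * q + 2)"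
    using n by (intro eq) auto
  ultimately have "(p1 = q + 1 \<and> p2 = 3 * q + 2) \<or> (p2 = q + 1 \<and> p1 = 3 * q + 2)"
    unfolding nodes_upto_def of_bool_def by (auto split: if_splits)
  then show ?thesis by auto
qed

lemma pair_energy_optimal:
  assumes n: "n = 4 * q + 2"
  shows "pair_energy n (q + 1) (3 * q + 2) \<le> pair_energy n p1 p2"
  unfolding pair_energy_def
proof (rule sum_mono)
  fix k assume "k \<in> {1..n}"
  then show "(nodes_upto (q + 1) (3 * q + 2) k - 2 * real k / real n)\<^sup>2
      \<le> (nodes_upto p1 p2 k - 2 * real k / real n)\<^sup>2"
    using nodes_upto_dist[of "q + 1" "3 * q + 2" k p1 p2] nearest_square_less[OF nodes_upto_nearest[OF n]]
    by (auto intro: less_imp_le)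
qed

lemma pair_energy_optimal_strict:
  assumes n: "n = 4 * q + 2" and p: "p1 \<in> {1..n}" "p2 \<in> {1..n}"
    and neq: "{p1, p2} \<noteq> {q + 1, 3 * q + 2}"
  shows "pair_energy n (q + 1) (3 * q + 2) < pair_energy n p1 p2"
proof -
  have lt: "(nodes_upto (q + 1) (3 * q + 2) k - 2 * real k / real n)\<^sup>2
      < (nodes_upto p1 p2 k - 2 * real k / real n)\<^sup>2"
    if "k \<in> {1..n}" "nodes_upto (q + 1) (3 * q + 2) k \<noteq> nodes_upto p1 p2 k" for k
    using nodes_upto_dist[of "q + 1" "3 * q + 2" k p1 p2]
      nearest_square_less[OF nodes_upto_nearest[OF n]] that by auto
  obtain k where k: "k \<in> {1..n}" "nodes_upto (q + 1) (3 * q + 2) k \<noteq> nodes_upto p1 p2 k"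
    using nodes_upto_determines_pair[OF n p] neq by blast
  show ?thesis unfolding pair_energy_def
  proof (rule sum_strict_mono_ex1)
    show "\<forall>k\<in>{1..n}. (nodes_upto (q + 1) (3 * q + 2) k - 2 * real k / real n)\<^sup>2
        \<le> (nodes_upto p1 p2 k - 2 * real k / real n)\<^sup>2"
      using lt by (metis less_imp_le order_refl)
    show "\<exists>k\<in>{1..n}. (nodes_upto (q + 1) (3 * q + 2) k - 2 * real k / real n)\<^sup>2
        < (nodes_upto p1 p2 k - 2 * real k / real n)\<^sup>2"
      using lt k by blast
  qed simp
qed

section \<open>Trigonometric sums\<close>

lemma sin_add_minus_sin_diff: "sin (u + y) - sin (u - y) = 2 * sin y * cos (u :: real)"
  by (simp add: sin_add sin_diff)

text \<open>Dirichlet kernel: multiplied by 2 sin y the sum telescopes, and the upper end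
  contributes nothing because (2q + 1) y is a multiple of \<pi>.\<close>

lemma sum_cos_half_period:
  assumes "1 \<le> k" "k \<le> 2 * q"
  shows "(\<Sum>t=1..q. cos (2 * real k * (pi * real t / real (2 * q + 1)))) = - 1 / 2"
proof -
  define y where "y = pi * real k / real (2 * q + 1)"
  have "0 < y" using assms by (simp add: y_def)
  moreover have "y < pi"
  proof -
    have "real k < real (2 * q + 1)" using assms by linarith
    then show ?thesis unfolding y_def by (simp add: pos_divide_less_eq)
  qed
  ultimately have s: "sin y > 0" by (rule sin_gt_zero)
  have tel: "2 * sin y * (\<Sum>t=1..m. cos (2 * real t * y)) = sin ((2 * real m + 1) * y) - sin y" for m
  proof (induction m)
    case (Suc m)
    have "sin ((2 * real (Suc m) + 1) * y) - sin ((2 * real m + 1) * y) = 2 * sin y * cos (2 * real (Suc m) * y)"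
      using sin_add_minus_sin_diff[of "2 * real (Suc m) * y" y] by (simp add: algebra_simps)
    with Suc show ?case by (simp add: algebra_simps)
  qed simp
  have "(2 * real q + 1) * y = real k * pi" unfolding y_def by (simp add: field_simps)
  then have "sin ((2 * real q + 1) * y) = 0" by (simp add: sin_npi)
  then have "sin y * (2 * (\<Sum>t=1..q. cos (2 * real t * y)) + 1) = 0"
    using tel[of q] by (simp add: algebra_simps)
  then have "(\<Sum>t=1..q. cos (2 * real t * y)) = - 1 / 2" using s by simp
  moreover have "2 * real k * (pi * real t / real (2 * q + 1)) = 2 * real t * y" for t
    by (simp add: y_def)
  ultimately show ?thesis by (simp only:)
qed

text \<open>The second difference in k of sin^2(k x) / sin^2(x) is 2 cos(2 (k + 1) x). Summed over t
  this is -1, so the sum is a quadratic in k, fixed by its values 0 at k = 0 and q at k = 1.\<close>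

lemma sum_sin_ratio_squared:
  assumes "k \<le> 2 * q + 1"
  shows "(\<Sum>t=1..q. (sin (real k * (pi * real t / real (2 * q + 1))))\<^sup>2 /
            (sin (pi * real t / real (2 * q + 1)))\<^sup>2) = real k * (real (2 * q + 1) - real k) / 2"
proof -
  define x where "x t = pi * real t / real (2 * q + 1)" for t
  have sx: "sin (x t) \<noteq> 0" if "t \<in> {1..q}" for t
  proof -
    have "0 < x t" using that by (simp add: x_def)
    moreover have "x t < pi"
    proof -
      have "real t < real (2 * q + 1)" using that by simp
      then show ?thesis unfolding x_def by (simp add: pos_divide_less_eq)
    qed
    ultimately show ?thesis using sin_gt_zero by force
  qed
  define s where "s k = (\<Sum>t=1..q. (sin (real k * x t))\<^sup>2 / (sin (x t))\<^sup>2)" for k :: nat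
  have s0: "s 0 = 0" by (simp add: s_def)
  have s1: "s 1 = real q" using sx by (simp add: s_def)
  have diff2: "s (Suc (Suc k)) = 2 * s (Suc k) - s k - 1" if "Suc k \<le> 2 * q" for k
  proof -
    have "(sin (real (Suc (Suc k)) * y))\<^sup>2 - 2 * (sin (real (Suc k) * y))\<^sup>2 + (sin (real k * y))\<^sup>2
        = 2 * cos (2 * real (Suc k) * y) * (sin y)\<^sup>2" for y :: real
    proof -
      define u where "u = real (Suc k) * y"
      have e: "real (Suc (Suc k)) * y = u + y" "real k * y = u - y" "2 * real (Suc k) * y = 2 * u"
        by (simp_all add: u_def algebra_simps)
      have c: "(cos a)\<^sup>2 = 1 - (sin a)\<^sup>2" for a :: real using sin_cos_squared_add[of a] by linarith
      have "(sin (u + y))\<^sup>2 + (sin (u - y))\<^sup>2 = 2 * (sin u)\<^sup>2 * (cos y)\<^sup>2 + 2 * (cos u)\<^sup>2 * (sin y)\<^sup>2"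
        unfolding sin_add sin_diff by (simp add: power2_eq_square algebra_simps)
      also have "\<dots> = 2 * (sin u)\<^sup>2 + 2 * (1 - 2 * (sin u)\<^sup>2) * (sin y)\<^sup>2"
        unfolding c by (simp add: algebra_simps)
      finally show ?thesis unfolding e u_def[symmetric] cos_double_sin by (simp add: algebra_simps)
    qed
    then have "(sin (real (Suc (Suc k)) * x t))\<^sup>2 / (sin (x t))\<^sup>2 - 2 * ((sin (real (Suc k) * x t))\<^sup>2 / (sin (x t))\<^sup>2)
        + (sin (real k * x t))\<^sup>2 / (sin (x t))\<^sup>2 = 2 * cos (2 * real (Suc k) * x t)" if "t \<in> {1..q}" for t
      using sx[OF that] by (simp add: divide_simps del: of_nat_Suc)
    then have "(\<Sum>t=1..q. (sin (real (Suc (Suc k)) * x t))\<^sup>2 / (sin (x t))\<^sup>2 - 2 * ((sin (real (Suc k) * x t))\<^sup>2 / (sin (x t))\<^sup>2)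
        + (sin (real k * x t))\<^sup>2 / (sin (x t))\<^sup>2) = (\<Sum>t=1..q. 2 * cos (2 * real (Suc k) * x t))"
      by (rule sum.cong[OF refl])
    then have "s (Suc (Suc k)) - 2 * s (Suc k) + s k = 2 * (\<Sum>t=1..q. cos (2 * real (Suc k) * x t))"
      unfolding s_def by (simp only: sum.distrib sum_subtractf sum_distrib_left)
    also have "\<dots> = - 1"
      using sum_cos_half_period[of "Suc k" q] that by (simp add: x_def)
    finally show ?thesis by simp
  qed
  have "s k = real k * (real (2 * q + 1) - real k) / 2" if "k \<le> 2 * q + 1" for k
    using that
  proof (induction k rule: induct_nat_012)
    case 0
    then show ?case by (simp add: s0)
  next
    case 1
    then show ?case using s1 by simp
  next
    case (ge2 k)
    then show ?case using diff2[of k] by (simp add: field_simps)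
  qed
  then show ?thesis using assms unfolding s_def x_def by blast
qed

lemma sum_sin_squared_period:
  assumes "1 \<le> t" "t < N"
  shows "(\<Sum>k<N. (sin (real k * (pi * real t / real N)))\<^sup>2) = real N / 2"
proof -
  define y where "y = pi * real t / real N"
  have "0 < y" using assms by (simp add: y_def)
  moreover have "y < pi" using assms unfolding y_def by (simp add: field_simps)
  ultimately have s: "sin y > 0" by (rule sin_gt_zero)
  have tel: "4 * sin y * (\<Sum>k<m. (sin (real k * y))\<^sup>2) = 2 * real m * sin y - sin ((2 * real m - 1) * y) - sin y" for m
  proof (induction m)
    case (Suc m)
    have "sin ((2 * real (Suc m) - 1) * y) - sin ((2 * real m - 1) * y) = 2 * sin y * cos (2 * (real m * y))"
      using sin_add_minus_sin_diff[of "2 * (real m * y)" y] by (simp add: algebra_simps)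
    also have "\<dots> = 2 * sin y - 4 * sin y * (sin (real m * y))\<^sup>2"
      unfolding cos_double_sin by (simp add: algebra_simps)
    finally show ?case using Suc by (simp add: algebra_simps)
  qed simp
  have "sin ((2 * real N - 1) * y) = sin (real t * (2 * pi) - y)"
    using assms by (simp add: y_def field_simps)
  also have "\<dots> = - sin y"
    using sin_2npi[of t] cos_2npi[of t] by (simp add: sin_diff ac_simps)
  finally have "sin y * (4 * (\<Sum>k<N. (sin (real k * y))\<^sup>2) - 2 * real N) = 0"
    using tel[of N] by (simp add: algebra_simps)
  then show ?thesis using s by (simp add: y_def)
qed

text \<open>Sum the previous two identities over k in both orders.\<close>

lemma sum_inverse_sin_squared:
  "(\<Sum>t=1..q. 1 / (sin (pi * real t / real (2 * q + 1)))\<^sup>2) = 2 * real q * (real q + 1) / 3"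
proof -
  let ?N = "2 * q + 1"
  let ?x = "\<lambda>t. pi * real t / real ?N"
  have "(\<Sum>t=1..q. 1 / (sin (?x t))\<^sup>2) * (real ?N / 2)
      = (\<Sum>t=1..q. (\<Sum>k<?N. (sin (real k * ?x t))\<^sup>2) / (sin (?x t))\<^sup>2)"
    unfolding sum_distrib_right
  proof (rule sum.cong)
    fix t assume "t \<in> {1..q}"
    then show "1 / (sin (?x t))\<^sup>2 * (real ?N / 2) = (\<Sum>k<?N. (sin (real k * ?x t))\<^sup>2) / (sin (?x t))\<^sup>2"
      by (subst sum_sin_squared_period) auto
  qed simp
  also have "\<dots> = (\<Sum>k<?N. \<Sum>t=1..q. (sin (real k * ?x t))\<^sup>2 / (sin (?x t))\<^sup>2)"
    unfolding sum_divide_distrib by (rule sum.swap)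
  also have "\<dots> = (\<Sum>k<?N. real k * (real ?N - real k) / 2)"
    by (intro sum.cong sum_sin_ratio_squared) auto
  also have "\<dots> = real ?N * (2 * real q * (real q + 1)) / 6"
  proof -
    have "(\<Sum>k<m. real k * (c - real k) / 2) = real m * (real m - 1) * (3 * c - 2 * real m + 1) / 12" for m and c :: real
      by (induction m) (auto simp: field_simps)
    from this[of "real ?N" ?N] show ?thesis by (simp only:) (simp add: field_simps)
  qed
  finally have "real ?N * (3 * (\<Sum>t=1..q. 1 / (sin (?x t))\<^sup>2)) = real ?N * (2 * real q * (real q + 1))"
    by (simp only: mult.commute[of _ "real ?N / 2"])
  then have "3 * (\<Sum>t=1..q. 1 / (sin (?x t))\<^sup>2) = 2 * real q * (real q + 1)"
    by (subst (asm) mult_cancel_left) simp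
  then show ?thesis by linarith
qed

text \<open>The squared norm of a nonconstant cosine eigenvector of the path, which is the inner sum
  in (1); again the sum telescopes after multiplication by a sine.\<close>

lemma sum_cos_squared_midpoints:
  assumes "1 \<le> m" "m < n"
  shows "(\<Sum>p=1..n. (cos (pi * real m * (real p - 1 / 2) / real n))\<^sup>2) = real n / 2"
proof -
  define y where "y = pi * real m / real n"
  have "0 < y" using assms by (simp add: y_def)
  moreover have "y < pi" using assms unfolding y_def by (simp add: field_simps)
  ultimately have s: "sin y > 0" by (rule sin_gt_zero)
  have tel: "4 * sin y * (\<Sum>p=1..l. (cos (y * (real p - 1 / 2)))\<^sup>2) = 2 * real l * sin y + sin (2 * real l * y)" for l
  proof (induction l)
    case (Suc l)
    have "sin (2 * real (Suc l) * y) - sin (2 * real l * y) = 2 * sin y * cos (2 * (y * (real (Suc l) - 1 / 2)))"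
      using sin_add_minus_sin_diff[of "2 * (y * (real (Suc l) - 1 / 2))" y] by (simp add: algebra_simps)
    also have "\<dots> = 4 * sin y * (cos (y * (real (Suc l) - 1 / 2)))\<^sup>2 - 2 * sin y"
      unfolding cos_double_cos by (simp add: algebra_simps)
    finally show ?case using Suc by (simp add: algebra_simps)
  qed simp
  have "2 * real n * y = real m * (2 * pi)" using assms by (simp add: y_def)
  then have "sin (2 * real n * y) = sin (2 * real m * pi)" by (simp only: ac_simps)
  then have "sin (2 * real n * y) = 0" by (simp only: sin_2npi)
  then have "sin y * (4 * (\<Sum>p=1..n. (cos (y * (real p - 1 / 2)))\<^sup>2) - 2 * real n) = 0"
    using tel[of n] by (simp add: algebra_simps)
  then have "(\<Sum>p=1..n. (cos (y * (real p - 1 / 2)))\<^sup>2) = real n / 2" using s by simp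
  moreover have "pi * real m * (real p - 1 / 2) / real n = y * (real p - 1 / 2)" for p
    by (simp add: y_def)
  ultimately show ?thesis by simp
qed

text \<open>The sum is 2 cos(\<pi> m/2) cos(\<pi> m/4). The first factor vanishes for odd m, the
  second for m twice an odd number.\<close>

lemma cos_quarter_sum_squared:
  "(cos (pi * real m / 4) + cos (3 * pi * real m / 4))\<^sup>2 = (if 4 dvd m then 4 else 0)"
proof -
  have sum: "cos (pi * real m / 4) + cos (3 * pi * real m / 4)
      = 2 * cos (pi * real m / 2) * cos (pi * real m / 4)"
    by (subst cos_plus_cos)
       (simp add: add_divide_distrib[symmetric] diff_divide_distrib[symmetric])
  show ?thesis
  proof (cases "4 dvd m")
    case True
    then obtain t where t: "m = 4 * t" by auto
    have "pi * real m / 2 = real t * (2 * pi)" "pi * real m / 4 = real t * pi" by (simp_all add: t)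
    moreover have "cos (real t * (2 * pi)) = 1" using cos_2npi[of t] by (simp add: ac_simps)
    ultimately have "cos (pi * real m / 2) = 1" "(cos (pi * real m / 4))\<^sup>2 = 1"
      by (simp_all only: cos_npi) (simp flip: power_mult)
    then show ?thesis unfolding sum using True by (simp add: power_mult_distrib)
  next
    case False
    have "cos (pi * real m / 2) = 0 \<or> cos (pi * real m / 4) = 0"
    proof (cases "even m")
      case True
      then obtain r where r: "m = 2 * r" by auto
      then have "odd r" using \<open>\<not> 4 dvd m\<close> by presburger
      moreover have "pi * real m / 4 = real r * (pi / 2)" by (simp add: r)
      ultimately show ?thesis unfolding cos_zero_iff by auto
    next
      case False
      moreover have "pi * real m / 2 = real m * (pi / 2)" by simp
      ultimately show ?thesis unfolding cos_zero_iff by auto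
    qed
    then show ?thesis unfolding sum using False by auto
  qed
qed

lemma sum_multiples_of_four:
  fixes g :: "nat \<Rightarrow> real"
  assumes "n = 4 * q + 2"
  shows "(\<Sum>j=2..n. if 4 dvd (j - 1) then g (j - 1) else 0) = (\<Sum>t=1..q. g (4 * t))"
proof -
  have "(\<Sum>j=2..n. if 4 dvd (j - 1) then g (j - 1) else 0) = (\<Sum>j\<in>{j\<in>{2..n}. 4 dvd (j - 1)}. g (j - 1))"
    by (simp add: sum.If_cases Int_def)
  also have "{j\<in>{2..n}. 4 dvd (j - 1)} = (\<lambda>t. 4 * t + 1) ` {1..q}"
  proof (intro equalityI subsetI)
    fix j assume "j \<in> {j\<in>{2..n}. 4 dvd (j - 1)}"
    then show "j \<in> (\<lambda>t. 4 * t + 1) ` {1..q}"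
      using assms by (intro image_eqI[of _ _ "(j - 1) div 4"]) auto
  qed (use assms in auto)
  also have "(\<Sum>j\<in>(\<lambda>t. 4 * t + 1) ` {1..q}. g (j - 1)) = (\<Sum>t=1..q. g (4 * t))"
    by (subst sum.reindex) (auto simp: inj_on_def)
  finally show ?thesis .
qed

text \<open>Only j = 4t + 1 survives, with numerator 4 and inner sum n/2, whence the factor 8/n. The
  angle 4t \<pi> / (2n) is \<pi> t / (2q + 1), and inverse squared sines remain to be
  summed.\<close>

lemma trig_sum_eq:
  assumes n: "n = 4 * q + 2"
  shows "(\<Sum>j=2..n. (cos (pi * (real j - 1) / 4) + cos (3 * pi * (real j - 1) / 4))\<^sup>2 /
            ((sin (pi * (real j - 1) / (2 * real n)))\<^sup>2 *
             (\<Sum>p=1..n. (cos (pi * (real j - 1) * (real p - 1 / 2) / real n))\<^sup>2)))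
       = ((real n)\<^sup>2 - 4) / (3 * real n)"
proof -
  let ?g = "\<lambda>m. 8 / real n * (1 / (sin (pi * real m / (2 * real n)))\<^sup>2)"
  have "(\<Sum>j=2..n. (cos (pi * (real j - 1) / 4) + cos (3 * pi * (real j - 1) / 4))\<^sup>2 /
            ((sin (pi * (real j - 1) / (2 * real n)))\<^sup>2 *
             (\<Sum>p=1..n. (cos (pi * (real j - 1) * (real p - 1 / 2) / real n))\<^sup>2)))
      = (\<Sum>j=2..n. if 4 dvd (j - 1) then ?g (j - 1) else 0)"
  proof (rule sum.cong)
    fix j assume j: "j \<in> {2..n}"
    then have "real j - 1 = real (j - 1)" "1 \<le> j - 1" "j - 1 < n" by auto
    then show "(cos (pi * (real j - 1) / 4) + cos (3 * pi * (real j - 1) / 4))\<^sup>2 /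
            ((sin (pi * (real j - 1) / (2 * real n)))\<^sup>2 *
             (\<Sum>p=1..n. (cos (pi * (real j - 1) * (real p - 1 / 2) / real n))\<^sup>2))
        = (if 4 dvd (j - 1) then ?g (j - 1) else 0)"
      by (simp only: cos_quarter_sum_squared sum_cos_squared_midpoints) (simp add: field_simps)
  qed simp
  also have "\<dots> = (\<Sum>t=1..q. ?g (4 * t))" by (rule sum_multiples_of_four[OF n])
  also have "\<dots> = 8 / real n * (\<Sum>t=1..q. 1 / (sin (pi * real t / real (2 * q + 1)))\<^sup>2)"
  proof -
    have "pi * real (4 * t) / (2 * real n) = pi * real t / real (2 * q + 1)" for t
      by (simp add: n field_simps)
    then show ?thesis by (simp only: sum_distrib_left)
  qed
  also have "\<dots> = ((real n)\<^sup>2 - 4) / (3 * real n)"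
    unfolding sum_inverse_sin_squared by (simp add: n field_simps power2_eq_square)
  finally show ?thesis .
qed

section \<open>Spectrum of the path Laplacian\<close>

text \<open>Local form of the eigenvalue equation: s is a factor that is constant near the index i
  (used with values 1, -1 and 0), and the last two assumptions are the free ends of the path.\<close>

lemma path_laplacian_mult_wave:
  assumes n: "2 \<le> n" and i: "i < n"
    and f: "f i = s * cos (u + real i * \<theta>)"
    and l: "0 < i \<Longrightarrow> f (i - 1) = s * cos (u + (real i - 1) * \<theta>)"
    and r: "Suc i < n \<Longrightarrow> f (Suc i) = s * cos (u + (real i + 1) * \<theta>)"
    and l0: "i = 0 \<Longrightarrow> s * cos (u - \<theta>) = s * cos u"
    and r0: "Suc i = n \<Longrightarrow> s * cos (u + real n * \<theta>) = s * cos (u + (real n - 1) * \<theta>)"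
  shows "(path_laplacian n *\<^sub>v vec n f) $ i = (2 - 2 * cos \<theta>) * f i"
proof -
  have L: "(if i = 0 then 0 else f i - f (i - 1)) = f i - s * cos (u + real i * \<theta> - \<theta>)"
    using f l l0 by (auto simp: algebra_simps)
  have R: "(if Suc i < n then f i - f (Suc i) else 0) = f i - s * cos (u + real i * \<theta> + \<theta>)"
  proof (cases "Suc i < n")
    case True
    then show ?thesis using r by (simp add: algebra_simps)
  next
    case False
    then have "Suc i = n" using i by simp
    then show ?thesis using r0 f False by (auto simp: algebra_simps)
  qed
  have "s * cos (u + real i * \<theta> - \<theta>) + s * cos (u + real i * \<theta> + \<theta>) = 2 * cos \<theta> * f i"
    unfolding f by (simp add: cos_diff cos_add algebra_simps)
  then show ?thesis unfolding path_laplacian_mult_vec[OF n i] L R by (simp add: algebra_simps)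
qed

definition path_eigenfun :: "nat \<Rightarrow> nat \<Rightarrow> nat \<Rightarrow> real" where
  "path_eigenfun n k i = cos (pi * real k * (2 * real i + 1) / (2 * real n))"

definition path_eigenval :: "nat \<Rightarrow> nat \<Rightarrow> real" where
  "path_eigenval n k = 2 - 2 * cos (pi * real k / real n)"

lemma path_eigenfun_wave:
  "path_eigenfun n k i = cos (pi * real k / real n / 2 + real i * (pi * real k / real n))"
  unfolding path_eigenfun_def
  by (rule arg_cong[where f = cos], cases "n = 0") (simp_all add: field_simps)

text \<open>The wave is symmetric about the positions -1/2 and n - 1/2. A fictitious neighbour
  beyond an end thus repeats the end value, and the end rows obey the interior recurrence.\<close>

lemma path_eigenfun_ends:
  fixes n k :: nat
  assumes "0 < n"
  defines "\<theta> \<equiv> pi * real k / real n"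
  shows "cos (\<theta> / 2 - \<theta>) = cos (\<theta> / 2)"
    and "cos (\<theta> / 2 + real n * \<theta>) = cos (\<theta> / 2 + (real n - 1) * \<theta>)"
proof -
  have "\<theta> / 2 - \<theta> = - (\<theta> / 2)" by simp
  then show "cos (\<theta> / 2 - \<theta>) = cos (\<theta> / 2)" by (simp only: cos_minus)
  have e: "\<theta> / 2 + real n * \<theta> = real k * pi + \<theta> / 2" "\<theta> / 2 + (real n - 1) * \<theta> = real k * pi - \<theta> / 2"
    using assms by (simp_all add: field_simps)
  show "cos (\<theta> / 2 + real n * \<theta>) = cos (\<theta> / 2 + (real n - 1) * \<theta>)"
    unfolding e by (simp add: cos_add cos_diff sin_npi)
qed

lemma path_laplacian_eigenfun:
  assumes n: "2 \<le> n" and i: "i < n"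
  shows "(path_laplacian n *\<^sub>v vec n (path_eigenfun n k)) $ i = path_eigenval n k * path_eigenfun n k i"
  unfolding path_eigenval_def
  by (rule path_laplacian_mult_wave[OF n i, where s = 1 and u = "pi * real k / real n / 2"])
     (use n path_eigenfun_ends[of n k] in \<open>auto simp: path_eigenfun_wave of_nat_diff algebra_simps\<close>)

lemma path_eigenval_strict_mono:
  assumes "j < k" "k < n"
  shows "path_eigenval n j < path_eigenval n k"
proof -
  have "pi * real j / real n < pi * real k / real n" using assms by (simp add: divide_strict_right_mono)
  moreover have "pi * real k / real n \<le> pi" using assms by (simp add: field_simps)
  moreover have "0 \<le> pi * real j / real n" by simp
  ultimately have "cos (pi * real k / real n) < cos (pi * real j / real n)"
    by (intro cos_monotone_0_pi)
  then show ?thesis by (simp add: path_eigenval_def)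
qed

lemma path_eigenfun_0_pos:
  assumes "k < n"
  shows "0 < path_eigenfun n k 0"
proof -
  have "pi * real k / (2 * real n) < pi / 2" using assms by (simp add: field_simps)
  moreover have "0 \<le> pi * real k / (2 * real n)" by simp
  ultimately show ?thesis unfolding path_eigenfun_def
    by (intro cos_gt_zero_pi) (auto intro: less_le_trans[of _ 0])
qed

lemma path_eigenval_eigenvalue:
  assumes "2 \<le> n" "k < n"
  shows "eigenvalue (path_laplacian n) (path_eigenval n k)"
  using path_eigenfun_0_pos[OF assms(2)] path_laplacian_eigenfun[OF assms(1)] assms
  by (intro eigenvalueI[where f = "path_eigenfun n k" and i = 0 and n = n]) auto

text \<open>The n cosine eigenvalues are distinct roots of a polynomial of degree n, hence all of
  its roots and all simple. Their index starts at 0, which accounts for k - 1.\<close>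

lemma kth_smallest_eigenvalue_path_laplacian:
  assumes n: "2 \<le> n" and k: "1 \<le> k" "k \<le> n"
  shows "kth_smallest_eigenvalue (path_laplacian n) k = path_eigenval n (k - 1)"
proof -
  let ?P = "char_poly (path_laplacian n)"
  let ?xs = "map (path_eigenval n) [0..<n]"
  have deg: "degree ?P = n" and P0: "?P \<noteq> 0"
    using degree_monic_char_poly[OF path_laplacian_carrier, of n] n by auto
  have "sorted_wrt (<) ?xs"
    unfolding sorted_wrt_iff_nth_less using path_eigenval_strict_mono by auto
  then have xs: "sorted ?xs" "distinct ?xs" by (simp_all add: strict_sorted_iff)
  have sub: "mset_set (set ?xs) \<subseteq># proots ?P"
  proof (rule mset_subset_eqI)
    fix a
    have "order a ?P \<noteq> 0" if "a \<in> set ?xs"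
    proof -
      have "eigenvalue (path_laplacian n) a" using that path_eigenval_eigenvalue[OF n] by auto
      then have "poly ?P a = 0" using eigenvalue_root_char_poly[OF path_laplacian_carrier] by blast
      then show ?thesis using P0 by (simp add: order_root)
    qed
    then show "count (mset_set (set ?xs)) a \<le> count (proots ?P) a"
      using P0 by (cases "a \<in> set ?xs") (auto simp: Suc_le_eq simp del: set_map)
  qed
  have "size (mset_set (set ?xs)) = n" using distinct_card[OF xs(2)] by simp
  moreover have "size (proots ?P) \<le> n" using size_proots_le[of ?P] deg by simp
  ultimately have "proots ?P = mset_set (set ?xs)"
    using sub mset_subset_size by (metis leD subset_mset.le_imp_less_or_eq)
  then have "sorted_list_of_multiset (proots ?P) = ?xs"
    using xs by (simp only: sorted_list_of_mset_set sorted_list_of_set.idem_if_sorted_distinct)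
  then show ?thesis unfolding kth_smallest_eigenvalue_def using k by simp
qed

text \<open>Eigenspaces are one-dimensional: the eigenvalue equation determines every entry from
  entry 0, and the combination \<open>h\<close> vanishes at 0.\<close>

lemma path_laplacian_eigenfun_unique:
  assumes n: "2 \<le> n"
    and f: "\<And>i. i < n \<Longrightarrow> (path_laplacian n *\<^sub>v vec n f) $ i = \<mu> * f i"
    and g: "\<And>i. i < n \<Longrightarrow> (path_laplacian n *\<^sub>v vec n g) $ i = \<mu> * g i"
    and i: "i < n"
  shows "f i * g 0 = g i * f 0"
proof -
  define h where "h i = f i * g 0 - g i * f 0" for i
  have h: "(if i = 0 then 0 else h i - h (i - 1)) + (if Suc i < n then h i - h (Suc i) else 0) = \<mu> * h i"
    if "i < n" for i
  proof -
    have "(if i = 0 then 0 else h i - h (i - 1)) + (if Suc i < n then h i - h (Suc i) else 0)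
      = (path_laplacian n *\<^sub>v vec n f) $ i * g 0 - (path_laplacian n *\<^sub>v vec n g) $ i * f 0"
      unfolding path_laplacian_mult_vec[OF n that] h_def by (simp add: algebra_simps)
    also have "\<dots> = \<mu> * h i" unfolding f[OF that] g[OF that] h_def by (simp add: algebra_simps)
    finally show ?thesis .
  qed
  have "h i = 0 \<and> (Suc i < n \<longrightarrow> h (Suc i) = 0)" if "i < n" for i
    using that
  proof (induction i)
    case 0
    have "h 0 = 0" by (simp add: h_def)
    then show ?case using h[of 0] n by auto
  next
    case (Suc i)
    then have "h i = 0" "h (Suc i) = 0" by auto
    then show ?case using h[of "Suc i"] Suc.prems by (auto split: if_splits)
  qed
  then show ?thesis using i by (simp add: h_def)
qed

text \<open>The argument of the cosine is (2i + 1)/(2q + 1) times \<pi>/2. A zero means 2i + 1 = m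
  (2q + 1) with m odd, and i < n leaves only m = 1 and m = 3.\<close>

lemma path_eigenfun_2_zero_iff:
  assumes n: "n = 4 * q + 2" and i: "i < n"
  shows "path_eigenfun n 2 i = 0 \<longleftrightarrow> i = q \<or> i = 3 * q + 1"
proof -
  have "path_eigenfun n 2 i = cos (real_of_int (2 * int i + 1) / real_of_int (2 * int q + 1) * (pi / 2))"
    unfolding path_eigenfun_def n by (rule arg_cong[where f = cos]) (simp add: field_simps)
  also have "\<dots> = 0 \<longleftrightarrow> (\<exists>m::int. odd m \<and>
      real_of_int (2 * int i + 1) / real_of_int (2 * int q + 1) * (pi / 2) = of_int m * (pi / 2))"
    by (rule cos_zero_iff_int)
  also have "\<dots> \<longleftrightarrow> (\<exists>m::int. odd m \<and> 2 * int i + 1 = m * (2 * int q + 1))"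
  proof -
    have "real_of_int (2 * int i + 1) / real_of_int (2 * int q + 1) * (pi / 2) = of_int m * (pi / 2)
      \<longleftrightarrow> real_of_int (2 * int i + 1) = real_of_int (m * (2 * int q + 1))" for m
    proof -
      have div: "x / y * (pi / 2) = z * (pi / 2) \<longleftrightarrow> x = z * y" if "y \<noteq> 0" for x y z :: real
        using that by (simp add: nonzero_divide_eq_eq)
      have "real_of_int (2 * int q + 1) \<noteq> 0" by linarith
      then show ?thesis unfolding of_int_mult[of m] by (rule div)
    qed
    then show ?thesis unfolding of_int_eq_iff by simp
  qed
  also have "\<dots> \<longleftrightarrow> i = q \<or> i = 3 * q + 1"
  proof
    assume "\<exists>m::int. odd m \<and> 2 * int i + 1 = m * (2 * int q + 1)"
    then obtain m where m: "odd m" "2 * int i + 1 = m * (2 * int q + 1)" by auto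
    have "0 < m * (2 * int q + 1)" using m(2) by linarith
    then have "0 < m" by (simp add: zero_less_mult_iff)
    have "m * (2 * int q + 1) < 4 * (2 * int q + 1)" unfolding m(2)[symmetric] using i n by simp
    then have "m < 4" by (rule mult_right_less_imp_less) simp
    then have "m = 1 \<or> m = 3" using \<open>0 < m\<close> m(1) by presburger
    then show "i = q \<or> i = 3 * q + 1" using m(2) by auto
  next
    assume "i = q \<or> i = 3 * q + 1"
    then show "\<exists>m::int. odd m \<and> 2 * int i + 1 = m * (2 * int q + 1)"
      by (auto intro: exI[of _ 1] exI[of _ 3])
  qed
  finally show ?thesis .
qed

lemma third_eigenvector_zero_iff:
  assumes n: "n = 4 * q + 2" and "2 < n"
    and v: "eigenvector (path_laplacian n) v (kth_smallest_eigenvalue (path_laplacian n) 3)"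
    and i: "i < n"
  shows "v $ i = 0 \<longleftrightarrow> i = q \<or> i = 3 * q + 1"
proof -
  have n2: "2 \<le> n" using assms by simp
  have k: "kth_smallest_eigenvalue (path_laplacian n) 3 = path_eigenval n 2"
    using kth_smallest_eigenvalue_path_laplacian[of n 3] assms by simp
  have vn: "v \<in> carrier_vec n" "v \<noteq> 0\<^sub>v n" "path_laplacian n *\<^sub>v v = path_eigenval n 2 \<cdot>\<^sub>v v"
    using v path_laplacian_carrier[of n] unfolding eigenvector_def k by auto
  have vv: "vec n (\<lambda>i. v $ i) = v" using vn(1) by auto
  have u: "v $ j * path_eigenfun n 2 0 = path_eigenfun n 2 j * v $ 0" if "j < n" for j
  proof (rule path_laplacian_eigenfun_unique[OF n2 _ path_laplacian_eigenfun[OF n2] that])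
    fix i assume "i < n"
    then show "(path_laplacian n *\<^sub>v vec n (\<lambda>i. v $ i)) $ i = path_eigenval n 2 * v $ i"
      unfolding vv using vn(1,3) by simp
  qed
  have p: "0 < path_eigenfun n 2 0" using \<open>2 < n\<close> by (rule path_eigenfun_0_pos)
  have "v $ 0 \<noteq> 0"
  proof
    assume "v $ 0 = 0"
    then have "v $ j = 0" if "j < n" for j using u[OF that] p by simp
    then have "v = 0\<^sub>v n" using vn(1) by (intro eq_vecI) auto
    then show False using vn(2) by simp
  qed
  then have "v $ i = 0 \<longleftrightarrow> path_eigenfun n 2 i = 0"
    using u[OF i] p by (metis less_irrefl mult_eq_0_iff)
  then show ?thesis using path_eigenfun_2_zero_iff[OF n i] by simp
qed

section \<open>Removing two nodes\<close>

definition kept :: "nat \<Rightarrow> nat set \<Rightarrow> nat set" where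
  "kept n S = {i. i < n \<and> Suc i \<notin> S}"

lemma kept_subset: "kept n S \<subseteq> {..<n}" by (auto simp: kept_def)

text \<open>The identity matrix restricts to an identity matrix because \<open>pick\<close> is
  injective below the cardinality of the index set.\<close>

lemma Z_hat_eq:
  "Z_hat (Z_mat \<tau> (path_laplacian n)) S
    = 1\<^sub>m (card (kept n S)) - \<tau> \<cdot>\<^sub>m submatrix (path_laplacian n) (kept n S) (kept n S)"
proof -
  let ?I = "kept n S"
  have I: "{i. i < n \<and> i \<in> ?I} = ?I" by (auto simp: kept_def)
  have "submatrix (Z_mat \<tau> (path_laplacian n)) ?I ?I
      = 1\<^sub>m (card ?I) - \<tau> \<cdot>\<^sub>m submatrix (path_laplacian n) ?I ?I"
  proof (rule eq_matI)
    fix a b assume "a < dim_row (1\<^sub>m (card ?I) - \<tau> \<cdot>\<^sub>m submatrix (path_laplacian n) ?I ?I)"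
      "b < dim_col (1\<^sub>m (card ?I) - \<tau> \<cdot>\<^sub>m submatrix (path_laplacian n) ?I ?I)"
    then have ab: "a < card ?I" "b < card ?I" by (auto simp: dim_submatrix I)
    then have p: "pick ?I a < n" "pick ?I b < n"
      using pick_in_set_le[of a ?I] pick_in_set_le[of b ?I] by (auto simp: kept_def)
    have "pick ?I a = pick ?I b \<longleftrightarrow> a = b" using ab pick_mono_le by (metis nat_neq_iff)
    then show "submatrix (Z_mat \<tau> (path_laplacian n)) ?I ?I $$ (a, b)
        = (1\<^sub>m (card ?I) - \<tau> \<cdot>\<^sub>m submatrix (path_laplacian n) ?I ?I) $$ (a, b)"
      using ab p by (simp add: Z_mat_def submatrix_index dim_submatrix I)
  qed (simp_all add: dim_submatrix I Z_mat_def)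
  then show ?thesis unfolding Z_hat_def kept_def by (simp add: Z_mat_def)
qed

lemma lambda_max_Z_hat:
  assumes "0 < \<tau>" "eigenvalue (submatrix (path_laplacian n) (kept n S) (kept n S)) k"
  shows "lambda_max (Z_hat (Z_mat \<tau> (path_laplacian n)) S)
    = 1 - \<tau> * lambda_min (submatrix (path_laplacian n) (kept n S) (kept n S))"
  unfolding Z_hat_eq
  by (rule lambda_max_one_minus_smult[OF submatrix_carrier[OF path_laplacian_carrier kept_subset] assms])

lemma cos_strict_decreasing_pi_div:
  assumes "0 < a" "a < b"
  shows "cos (pi / real a) < cos (pi / real b)"
proof (rule cos_monotone_0_pi)
  show "0 \<le> pi / real b" by simp
  show "pi / real b < pi / real a" using assms by (intro divide_strict_left_mono) auto
  show "pi / real a \<le> pi" using assms by (simp add: field_simps)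
qed

lemma pi_div_mult: "0 < m \<Longrightarrow> pi / real m * real m = pi" by simp

text \<open>The three pieces are closed and share their zeros, so that the neighbours of a kept
  index are covered together with it.\<close>

lemma path_eigenfun_2_signs:
  assumes n: "n = 4 * q + 2"
  shows "i \<le> q \<Longrightarrow> 0 \<le> path_eigenfun n 2 i"
    and "q \<le> i \<Longrightarrow> i \<le> 3 * q + 1 \<Longrightarrow> path_eigenfun n 2 i \<le> 0"
    and "3 * q + 1 \<le> i \<Longrightarrow> i < n \<Longrightarrow> 0 \<le> path_eigenfun n 2 i"
proof -
  define x where "x = pi * (2 * real i + 1) / real n"
  have e: "path_eigenfun n 2 i = cos x" unfolding path_eigenfun_def x_def by simp
  have rn: "real n = 4 * real q + 2" "0 < real n" using n by auto
  have le: "pi * c \<le> x" if "c * real n \<le> 2 * real i + 1" for c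
    unfolding x_def using that rn(2) by (simp add: pos_le_divide_eq mult.assoc)
  have ge: "x \<le> pi * c" if "2 * real i + 1 \<le> c * real n" for c
    unfolding x_def using that rn(2) by (simp add: pos_divide_le_eq mult.assoc)
  have x0: "0 \<le> x" by (simp add: x_def)
  show "0 \<le> path_eigenfun n 2 i" if "i \<le> q"
  proof -
    have "real i \<le> real q" using that by simp
    then have "x \<le> pi * (1 / 2)" by (intro ge) (simp add: rn)
    then show ?thesis unfolding e using x0 by (intro cos_ge_zero) auto
  qed
  show "path_eigenfun n 2 i \<le> 0" if "q \<le> i" "i \<le> 3 * q + 1"
  proof -
    have "real q \<le> real i" "real i \<le> 3 * real q + 1" using that by linarith+
    then have "pi * (1 / 2) \<le> x" "x \<le> pi * (3 / 2)" by (intro le ge; simp add: rn)+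
    then have "0 \<le> cos (x - pi)" by (intro cos_ge_zero) auto
    then show ?thesis unfolding e by (simp add: cos_diff)
  qed
  show "0 \<le> path_eigenfun n 2 i" if "3 * q + 1 \<le> i" "i < n"
  proof -
    have "3 * real q + 1 \<le> real i" "real i + 1 \<le> real n" using that by linarith+
    then have "pi * (3 / 2) \<le> x" "x \<le> pi * 2" by (intro le ge; simp add: rn)+
    then have "0 \<le> cos (x - 2 * pi)" by (intro cos_ge_zero) auto
    then show ?thesis unfolding e by (simp add: cos_diff)
  qed
qed

lemma path_eigenval_2:
  assumes "n = 4 * q + 2"
  shows "path_eigenval n 2 = 2 - 2 * cos (pi / real (2 * q + 1))"
proof -
  have "pi * real 2 / real n = pi / real (2 * q + 1)" using assms by (simp add: field_simps)
  then show ?thesis by (simp only: path_eigenval_def)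
qed

text \<open>The absolute value of the third eigenvector of the path is an eigenvector of the
  submatrix, because its zeros are exactly the removed nodes.\<close>

lemma abs_path_eigenfun_2_eigen:
  assumes n: "n = 4 * q + 2" "2 < n" and i: "i \<in> kept n {q + 1, 3 * q + 2}"
  shows "(path_laplacian n *\<^sub>v vec n (\<lambda>i. \<bar>path_eigenfun n 2 i\<bar>)) $ i
    = path_eigenval n 2 * \<bar>path_eigenfun n 2 i\<bar>"
proof -
  have iq: "i < n" "i \<noteq> q" "i \<noteq> 3 * q + 1" using i by (auto simp: kept_def)
  \<comment> \<open>A kept index lies strictly between zeros or beyond one, so its neighbours belong
    to the same closed piece and one sign serves all these entries.\<close>
  obtain s where s: "s = 1 \<or> s = (-1 :: real)"
    "\<And>j. i \<le> Suc j \<Longrightarrow> j \<le> Suc i \<Longrightarrow> j < n \<Longrightarrow> \<bar>path_eigenfun n 2 j\<bar> = s * path_eigenfun n 2 j"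
  proof -
    consider "i < q" | "q < i" "i < 3 * q + 1" | "3 * q + 1 < i" using iq by linarith
    then show ?thesis
    proof cases
      case 1
      then show ?thesis using path_eigenfun_2_signs(1)[OF n(1)] by (intro that[of 1]) auto
    next
      case 2
      then show ?thesis using path_eigenfun_2_signs(2)[OF n(1)] by (intro that[of "-1"]) auto
    next
      case 3
      then show ?thesis using path_eigenfun_2_signs(3)[OF n(1)] by (intro that[of 1]) auto
    qed
  qed
  have "0 < n" using n by simp
  note ends = path_eigenfun_ends[OF this, of 2]
  show ?thesis unfolding path_eigenval_def
  proof (rule path_laplacian_mult_wave[where s = s and u = "pi * real 2 / real n / 2"])
    show "2 \<le> n" "i < n" using n iq by auto
    show "\<bar>path_eigenfun n 2 i\<bar> = s * cos (pi * real 2 / real n / 2 + real i * (pi * real 2 / real n))"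
      using s(2)[of i] iq(1) by (simp add: path_eigenfun_wave)
    show "\<bar>path_eigenfun n 2 (i - 1)\<bar>
        = s * cos (pi * real 2 / real n / 2 + (real i - 1) * (pi * real 2 / real n))" if "0 < i"
      using s(2)[of "i - 1"] iq(1) that by (simp add: path_eigenfun_wave of_nat_diff)
    show "\<bar>path_eigenfun n 2 (Suc i)\<bar>
        = s * cos (pi * real 2 / real n / 2 + (real i + 1) * (pi * real 2 / real n))" if "Suc i < n"
      using s(2)[of "Suc i"] that by (simp add: path_eigenfun_wave add.commute)
  qed (simp_all only: ends)
qed

text \<open>A positive eigenvector belongs to the smallest eigenvalue, since it is a supersolution
  with equality. Index 0 is kept because \<open>2 < n\<close> makes q positive.\<close>

lemma lambda_min_submatrix_optimal_ge:
  assumes n: "n = 4 * q + 2" "2 < n"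
  defines "I \<equiv> kept n {q + 1, 3 * q + 2}"
  shows "eigenvalue (submatrix (path_laplacian n) I I) (path_eigenval n 2)"
    and "path_eigenval n 2 \<le> lambda_min (submatrix (path_laplacian n) I I)"
proof -
  have IS: "I \<subseteq> {..<n}" unfolding I_def by (rule kept_subset)
  have supp: "\<bar>path_eigenfun n 2 i\<bar> = 0" if "i < n" "i \<notin> I" for i
    using that path_eigenfun_2_zero_iff[OF n(1), of i] by (auto simp: I_def kept_def)
  have pos: "0 < \<bar>path_eigenfun n 2 i\<bar>" if "i \<in> I" for i
    using that path_eigenfun_2_zero_iff[OF n(1), of i] by (auto simp: I_def kept_def)
  have "0 \<in> I" using n by (auto simp: I_def kept_def)
  show ev: "eigenvalue (submatrix (path_laplacian n) I I) (path_eigenval n 2)"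
    using pos[OF \<open>0 \<in> I\<close>] abs_path_eigenfun_2_eigen[OF n] supp \<open>0 \<in> I\<close> unfolding I_def
    by (intro eigenvalue_submatrixI[OF path_laplacian_carrier IS[unfolded I_def],
          where f = "\<lambda>i. \<bar>path_eigenfun n 2 i\<bar>" and i = 0]) auto
  show "path_eigenval n 2 \<le> lambda_min (submatrix (path_laplacian n) I I)"
  proof (rule lambda_min_ge[OF submatrix_carrier[OF path_laplacian_carrier IS] ev])
    fix k assume k: "eigenvalue (submatrix (path_laplacian n) I I) k"
    show "path_eigenval n 2 \<le> k"
      by (rule eigenvalue_submatrix_ge_of_supersolution[OF path_laplacian_carrier IS path_laplacian_off_diag
            supp pos _ k]) (auto simp: abs_path_eigenfun_2_eigen[OF n] I_def simp del: index_mult_mat_vec)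
  qed
qed

text \<open>A quarter wave with its crest at the position -1/2 and its zero at the removed index a =
  p1 - 1. Reflected in the free end it becomes a half wave of length 2a + 1, and in this sense an
  end block counts double.\<close>

lemma eigenvalue_left_block:
  assumes n: "2 \<le> n" and p: "1 < p1" "p1 < p2" "p2 \<le> n"
  shows "eigenvalue (submatrix (path_laplacian n) (kept n {p1, p2}) (kept n {p1, p2}))
    (2 - 2 * cos (pi / real (2 * (p1 - 1) + 1)))"
proof -
  define a where "a = p1 - 1"
  define \<theta> where "\<theta> = pi / real (2 * a + 1)"
  define F where "F x = cos (\<theta> / 2 + x * \<theta>)" for x :: real
  define f where "f i = (if i < a then F (real i) else 0)" for i
  have a: "0 < a" "a < n" "p1 = Suc a" using p by (auto simp: a_def)
  have "\<theta> * (2 * real a + 1) = pi"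
    using pi_div_mult[of "2 * a + 1"] by (simp add: \<theta>_def add.commute)
  then have "\<theta> / 2 + real a * \<theta> = pi / 2" by (simp add: algebra_simps)
  then have Fa: "F (real a) = 0" by (simp only: F_def cos_pi_half)
  have fle: "f i = F (real i)" if "i \<le> a" for i using that Fa by (cases "i = a") (auto simp: f_def)
  have "0 < \<theta>" "\<theta> < pi" using a by (auto simp: \<theta>_def field_simps)
  then have F0: "0 < F 0" unfolding F_def by (intro cos_gt_zero_pi) auto
  have "eigenvalue (submatrix (path_laplacian n) (kept n {p1, p2}) (kept n {p1, p2})) (2 - 2 * cos \<theta>)"
  proof (rule eigenvalue_submatrixI[OF path_laplacian_carrier kept_subset, where f = f and i = 0])
    show "f i = 0" if "i < n" "i \<notin> kept n {p1, p2}" for i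
      using that a p by (auto simp: kept_def f_def)
    show "0 \<in> kept n {p1, p2}" using a p by (auto simp: kept_def)
    show "f 0 \<noteq> 0" using F0 a by (simp add: f_def)
    fix i assume i: "i \<in> kept n {p1, p2}"
    then have ia: "i < n" "i \<noteq> a" using a by (auto simp: kept_def)
    show "(path_laplacian n *\<^sub>v vec n f) $ i = (2 - 2 * cos \<theta>) * f i"
    proof (cases "i < a")
      case True
      show ?thesis
        by (rule path_laplacian_mult_wave[OF n ia(1), where s = 1 and u = "\<theta> / 2"])
           (use True a in \<open>auto simp: fle F_def of_nat_diff add.commute cos_minus[of "\<theta> / 2", symmetric]
              simp del: cos_minus\<close>)
    next
      case False
      show ?thesis
        by (rule path_laplacian_mult_wave[OF n ia(1), where s = 0])
           (use False ia in \<open>auto simp: f_def\<close>)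
    qed
  qed
  then show ?thesis by (simp add: \<theta>_def a_def)
qed

lemma eigenvalue_right_block:
  assumes n: "2 \<le> n" and p: "1 \<le> p1" "p1 < p2" "p2 < n"
  shows "eigenvalue (submatrix (path_laplacian n) (kept n {p1, p2}) (kept n {p1, p2}))
    (2 - 2 * cos (pi / real (2 * (n - p2) + 1)))"
proof -
  define \<theta> where "\<theta> = pi / real (2 * (n - p2) + 1)"
  \<comment> \<open>This phase puts the crest at n - 1/2; the frequency then puts the zero at the
    removed index p2 - 1.\<close>
  define u where "u = - (real n - 1 / 2) * \<theta>"
  define F where "F x = cos (u + x * \<theta>)" for x :: real
  define f where "f i = (if p2 \<le> i then F (real i) else 0)" for i
  have "\<theta> * (2 * (real n - real p2) + 1) = pi"
    using p pi_div_mult[of "2 * (n - p2) + 1"] by (simp add: \<theta>_def of_nat_diff algebra_simps)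
  then have "u + (real p2 - 1) * \<theta> = - (pi / 2)" by (simp add: u_def algebra_simps)
  then have Fa: "F (real p2 - 1) = 0" by (simp only: F_def cos_minus cos_pi_half)
  have fle: "f i = F (real i)" if "p2 \<le> Suc i" for i
  proof (cases "p2 = Suc i")
    case True
    then show ?thesis using Fa by (simp add: f_def)
  qed (use that in \<open>simp add: f_def\<close>)
  have th: "0 < \<theta>" "\<theta> < pi" using p by (auto simp: \<theta>_def field_simps of_nat_diff)
  have e: "u + (real n - 1) * \<theta> = - (\<theta> / 2)" "u + real n * \<theta> = \<theta> / 2" by (simp_all add: u_def algebra_simps)
  have F0: "0 < F (real n - 1)" unfolding F_def e cos_minus using th by (intro cos_gt_zero_pi) auto
  have "eigenvalue (submatrix (path_laplacian n) (kept n {p1, p2}) (kept n {p1, p2})) (2 - 2 * cos \<theta>)"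
  proof (rule eigenvalue_submatrixI[OF path_laplacian_carrier kept_subset, where f = f and i = "n - 1"])
    show "f i = 0" if "i < n" "i \<notin> kept n {p1, p2}" for i
      using that p by (auto simp: kept_def f_def)
    show "n - 1 \<in> kept n {p1, p2}" using p by (auto simp: kept_def)
    show "f (n - 1) \<noteq> 0" using F0 p by (simp add: f_def of_nat_diff)
    fix i assume i: "i \<in> kept n {p1, p2}"
    then have ia: "i < n" "Suc i \<noteq> p2" by (auto simp: kept_def)
    show "(path_laplacian n *\<^sub>v vec n f) $ i = (2 - 2 * cos \<theta>) * f i"
    proof (cases "p2 \<le> i")
      case True
      show ?thesis
        by (rule path_laplacian_mult_wave[OF n ia(1), where s = 1 and u = u])
           (use True p in \<open>auto simp: fle F_def of_nat_diff add.commute e\<close>)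
    next
      case False
      show ?thesis
        by (rule path_laplacian_mult_wave[OF n ia(1), where s = 0])
           (use False ia in \<open>auto simp: f_def\<close>)
    qed
  qed
  then show ?thesis by (simp add: \<theta>_def)
qed

lemma eigenvalue_middle_block:
  assumes n: "2 \<le> n" and p: "1 \<le> p1" "Suc p1 < p2" "p2 \<le> n"
  shows "eigenvalue (submatrix (path_laplacian n) (kept n {p1, p2}) (kept n {p1, p2}))
    (2 - 2 * cos (pi / real (p2 - p1)))"
proof -
  define \<theta> where "\<theta> = pi / real (p2 - p1)"
  \<comment> \<open>This phase makes the argument -\<pi>/2 at the removed index p1 - 1 and, half a
    period later, \<pi>/2 at p2 - 1.\<close>
  define u where "u = (1 - real p1) * \<theta> - pi / 2"
  define F where "F x = cos (u + x * \<theta>)" for x :: real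
  define f where "f i = (if p1 \<le> i \<and> Suc i < p2 then F (real i) else 0)" for i
  have F1: "F (real p1 - 1) = 0" by (simp add: F_def u_def algebra_simps)
  have pp: "\<theta> * (real p2 - real p1) = pi" using p by (simp add: \<theta>_def of_nat_diff)
  then have "u + (real p2 - 1) * \<theta> = pi / 2" by (simp add: u_def algebra_simps)
  then have F2: "F (real p2 - 1) = 0" by (simp only: F_def cos_pi_half)
  have fle: "f i = F (real i)" if i: "p1 \<le> Suc i" "Suc i \<le> p2" for i
  proof -
    consider "p1 = Suc i" | "p2 = Suc i" | "p1 \<le> i" "Suc i < p2" using i by linarith
    then show ?thesis
    proof cases
      case 1
      then show ?thesis using F1 by (simp add: f_def)
    next
      case 2
      then show ?thesis using F2 by (simp add: f_def)
    qed (simp add: f_def)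
  qed
  have "1 < real (p2 - p1)" using p by simp
  then have th: "0 < \<theta>" "\<theta> < pi" by (simp_all add: \<theta>_def pos_divide_less_eq)
  have "u + real p1 * \<theta> = \<theta> - pi / 2" by (simp add: u_def algebra_simps)
  then have F0: "0 < F (real p1)" unfolding F_def using th by (simp add: cos_diff sin_gt_zero)
  have "eigenvalue (submatrix (path_laplacian n) (kept n {p1, p2}) (kept n {p1, p2})) (2 - 2 * cos \<theta>)"
  proof (rule eigenvalue_submatrixI[OF path_laplacian_carrier kept_subset, where f = f and i = p1])
    show "f i = 0" if "i < n" "i \<notin> kept n {p1, p2}" for i
      using that p by (auto simp: kept_def f_def)
    show "p1 \<in> kept n {p1, p2}" using p by (auto simp: kept_def)
    show "f p1 \<noteq> 0" using F0 p by (simp add: f_def)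
    fix i assume i: "i \<in> kept n {p1, p2}"
    then have ia: "i < n" "Suc i \<noteq> p1" "Suc i \<noteq> p2" by (auto simp: kept_def)
    show "(path_laplacian n *\<^sub>v vec n f) $ i = (2 - 2 * cos \<theta>) * f i"
    proof (cases "p1 \<le> i \<and> Suc i < p2")
      case True
      show ?thesis
        by (rule path_laplacian_mult_wave[OF n ia(1), where s = 1 and u = u])
           (use True p in \<open>auto simp: fle F_def of_nat_diff add.commute\<close>)
    next
      case False
      show ?thesis
        by (rule path_laplacian_mult_wave[OF n ia(1), where s = 0])
           (use False ia in \<open>auto simp: f_def\<close>)
    qed
  qed
  then show ?thesis by (simp add: \<theta>_def)
qed

text \<open>The lengths 2(p1 - 1) + 1, p2 - p1 and 2(n - p2) + 1 with weights 1, 2, 1 add up to 2n =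
  4(2q + 1). Hence one of them exceeds 2q + 1 unless all three are equal to it, which happens only
  for the optimal pair.\<close>

lemma eigenvalue_submatrix_lt:
  assumes n: "n = 4 * q + 2" and p: "1 \<le> p1" "p1 < p2" "p2 \<le> n"
    and neq: "{p1, p2} \<noteq> {q + 1, 3 * q + 2}"
  shows "\<exists>k<path_eigenval n 2.
    eigenvalue (submatrix (path_laplacian n) (kept n {p1, p2}) (kept n {p1, p2})) k"
proof -
  have n2: "2 \<le> n" using n by simp
  have lt: "2 - 2 * cos (pi / real m) < path_eigenval n 2" if "2 * q + 1 < m" for m
    unfolding path_eigenval_2[OF n] using cos_strict_decreasing_pi_div[OF _ that] by simp
  have "\<not> (p1 = q + 1 \<and> p2 = 3 * q + 2)" using neq by auto
  then consider "q + 1 < p1" | "q < n - p2" | "2 * q + 1 < p2 - p1" using n p by linarith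
  then show ?thesis
  proof cases
    case 1
    then show ?thesis using eigenvalue_left_block[OF n2, of p1 p2] p lt[of "2 * (p1 - 1) + 1"]
      by (intro exI[of _ "2 - 2 * cos (pi / real (2 * (p1 - 1) + 1))"] conjI) auto
  next
    case 2
    then show ?thesis using eigenvalue_right_block[OF n2, of p1 p2] p lt[of "2 * (n - p2) + 1"]
      by (intro exI[of _ "2 - 2 * cos (pi / real (2 * (n - p2) + 1))"] conjI) auto
  next
    case 3
    then show ?thesis using eigenvalue_middle_block[OF n2, of p1 p2] p lt[of "p2 - p1"]
      by (intro exI[of _ "2 - 2 * cos (pi / real (p2 - p1))"] conjI) auto
  qed
qed

section \<open>Unique optimizers over the two-element sets of nodes\<close>

lemma k_subset_2_cases:
  assumes "k_subset n 2 S"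
  obtains p1 p2 where "S = {p1, p2}" "1 \<le> p1" "p1 < p2" "p2 \<le> n"
proof -
  obtain x y where xy: "S = {x, y}" "x \<noteq> y" "x \<in> {1..n}" "y \<in> {1..n}"
    using assms unfolding k_subset_def card_2_iff by auto
  show thesis
  proof (cases "x < y")
    case True
    then show ?thesis using xy by (intro that[of x y]) auto
  next
    case False
    then show ?thesis using xy by (intro that[of y x]) auto
  qed
qed

lemma is_arg_min_iff_strict:
  fixes f :: "'a \<Rightarrow> 'b :: order"
  assumes "P x" "\<And>y. P y \<Longrightarrow> y \<noteq> x \<Longrightarrow> f x < f y"
  shows "is_arg_min f P y \<longleftrightarrow> y = x"
  using assms unfolding is_arg_min_def by (metis less_asym order.strict_implies_not_eq)

lemma is_arg_max_iff_strict:
  fixes f :: "'a \<Rightarrow> 'b :: order"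
  assumes "P x" "\<And>y. P y \<Longrightarrow> y \<noteq> x \<Longrightarrow> f y < f x"
  shows "is_arg_max f P y \<longleftrightarrow> y = x"
  using assms unfolding is_arg_max_def by (metis less_asym order.strict_implies_not_eq)

lemma optimal_pair_k_subset: "n = 4 * q + 2 \<Longrightarrow> k_subset n 2 {q + 1, 3 * q + 2}"
  by (auto simp: k_subset_def)

lemma MSub_LE_centers_path:
  assumes n: "n = 4 * q + 2" "2 < n" and \<tau>: "0 < \<tau>"
  shows "MSub_LE_centers (Z_mat \<tau> (path_laplacian n)) 2 S \<longleftrightarrow> S = {q + 1, 3 * q + 2}"
proof -
  have dim: "dim_row (Z_mat \<tau> (path_laplacian n)) = n"
    by (simp add: Z_mat_def)
  show ?thesis unfolding MSub_LE_centers_def dim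
  proof (rule is_arg_min_iff_strict[where P = "k_subset n 2", OF optimal_pair_k_subset[OF n(1)]])
    fix S assume "k_subset n 2 S" and neq: "S \<noteq> {q + 1, 3 * q + 2}"
    then obtain p1 p2 where p: "S = {p1, p2}" "1 \<le> p1" "p1 < p2" "p2 \<le> n"
      by (elim k_subset_2_cases)
    let ?A = "\<lambda>S. submatrix (path_laplacian n) (kept n S) (kept n S)"
    obtain k where k: "k < path_eigenval n 2" "eigenvalue (?A S) k"
      using eigenvalue_submatrix_lt[OF n(1) p(2-4)] neq p(1) by blast
    have "lambda_min (?A S) \<le> k"
      by (rule lambda_min_le[OF submatrix_carrier[OF path_laplacian_carrier kept_subset] k(2)])
    then have "lambda_min (?A S) < lambda_min (?A {q + 1, 3 * q + 2})"
      using k(1) lambda_min_submatrix_optimal_ge(2)[OF n] by linarith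
    then show "lambda_max (Z_hat (Z_mat \<tau> (path_laplacian n)) {q + 1, 3 * q + 2})
        < lambda_max (Z_hat (Z_mat \<tau> (path_laplacian n)) S)"
      unfolding lambda_max_Z_hat[OF \<tau> k(2)] lambda_max_Z_hat[OF \<tau> lambda_min_submatrix_optimal_ge(1)[OF n]]
      using \<tau> by simp
  qed
qed

section \<open>Centers of the path\<close>

text \<open>The nodes must differ, since a sum over the set {p1, p2} would count a repeated node
  once while \<open>L_two\<close> counts it twice.\<close>

lemma L_tilde_eq_L_two:
  assumes "p1 \<in> {1..n}" "p2 \<in> {1..n}" "p1 \<noteq> p2"
  shows "L_tilde (path_laplacian n) \<epsilon> {p1, p2} = L_two n (- \<epsilon>) p1 p2"
  by (rule eq_matI)
     (use assms in \<open>auto simp: L_tilde_def L_two_def sum_eeT_def eeT_index algebra_simps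
       eeT_def[THEN arg_cong[where f = dim_row]] eeT_def[THEN arg_cong[where f = dim_col]]\<close>)

lemma eventually_lambda_min_L_two_less:
  assumes n: "2 \<le> n" and p: "p1 \<in> {1..n}" "p2 \<in> {1..n}" and r: "r1 \<in> {1..n}" "r2 \<in> {1..n}"
    and less: "pair_energy n r1 r2 < pair_energy n p1 p2"
  shows "\<forall>\<^sub>F \<epsilon> in at_right 0. lambda_min (L_two n (- \<epsilon>) p1 p2) < lambda_min (L_two n (- \<epsilon>) r1 r2)"
proof -
  obtain C h where h: "0 < h" and C: "\<And>t. \<bar>t\<bar> \<le> h \<Longrightarrow> \<bar>lambda_min (L_two n t p1 p2)
      - (2 / real n * t - pair_energy n p1 p2 / real n * t\<^sup>2)\<bar> \<le> C * \<bar>t\<bar> ^ 3"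
    using lambda_min_L_two_expansion[OF n p] by blast
  obtain C' h' where h': "0 < h'" and C': "\<And>t. \<bar>t\<bar> \<le> h' \<Longrightarrow> \<bar>lambda_min (L_two n t r1 r2)
      - (2 / real n * t - pair_energy n r1 r2 / real n * t\<^sup>2)\<bar> \<le> C' * \<bar>t\<bar> ^ 3"
    using lambda_min_L_two_expansion[OF n r] by blast
  define D where "D = pair_energy n p1 p2 / real n - pair_energy n r1 r2 / real n"
  define K where "K = \<bar>C\<bar> + \<bar>C'\<bar> + 1"
  have D: "0 < D" using less n by (simp add: D_def divide_strict_right_mono)
  have K: "0 < K" by (simp add: K_def)
  show ?thesis unfolding eventually_at_right_field
  \<comment> \<open>The linear terms of the two expansions agree. Below D/K the two cubic errors
    together stay under the quadratic gap D \<epsilon>^2.\<close>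
  proof (intro exI[of _ "min h (min h' (D / K))"] conjI allI impI)
    show "0 < min h (min h' (D / K))" using h h' D K by simp
    fix \<epsilon> assume e: "0 < \<epsilon>" "\<epsilon> < min h (min h' (D / K))"
    have "\<epsilon> * K < D" using e K by (simp add: pos_less_divide_eq)
    moreover have "(C + C') * \<epsilon> \<le> K * \<epsilon>" using e(1) by (intro mult_right_mono) (auto simp: K_def)
    ultimately have "(C + C') * \<epsilon> < D" by (simp add: mult.commute)
    then have "\<epsilon>\<^sup>2 * ((C + C') * \<epsilon>) < \<epsilon>\<^sup>2 * D" using e(1) by (intro mult_strict_left_mono) auto
    then have "C * \<epsilon> ^ 3 + C' * \<epsilon> ^ 3 < pair_energy n p1 p2 / real n * \<epsilon>\<^sup>2 - pair_energy n r1 r2 / real n * \<epsilon>\<^sup>2"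
      unfolding D_def by (simp add: algebra_simps power2_eq_square power3_eq_cube)
    moreover have "\<bar>lambda_min (L_two n (- \<epsilon>) p1 p2)
        - (2 / real n * (- \<epsilon>) - pair_energy n p1 p2 / real n * \<epsilon>\<^sup>2)\<bar> \<le> C * \<epsilon> ^ 3"
      using C[of "- \<epsilon>"] e by (simp add: abs_of_pos)
    moreover have "\<bar>lambda_min (L_two n (- \<epsilon>) r1 r2)
        - (2 / real n * (- \<epsilon>) - pair_energy n r1 r2 / real n * \<epsilon>\<^sup>2)\<bar> \<le> C' * \<epsilon> ^ 3"
      using C'[of "- \<epsilon>"] e by (simp add: abs_of_pos)
    ultimately show "lambda_min (L_two n (- \<epsilon>) p1 p2) < lambda_min (L_two n (- \<epsilon>) r1 r2)"
      by linarith
  qed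
qed

text \<open>There are finitely many competing sets, so their individual ranges of \<epsilon> have a
  common part.\<close>

lemma eventually_optimal_pair:
  assumes n: "n = 4 * q + 2"
  shows "\<forall>\<^sub>F \<epsilon> in at_right 0. \<forall>S\<in>{S. k_subset n 2 S \<and> S \<noteq> {q + 1, 3 * q + 2}}.
    lambda_min (L_tilde (path_laplacian n) \<epsilon> S)
      < lambda_min (L_tilde (path_laplacian n) \<epsilon> {q + 1, 3 * q + 2})"
proof (rule eventually_ball_finite)
  show "finite {S. k_subset n 2 S \<and> S \<noteq> {q + 1, 3 * q + 2}}"
    by (rule finite_subset[of _ "Pow {1..n}"]) (auto simp: k_subset_def)
  show "\<forall>S\<in>{S. k_subset n 2 S \<and> S \<noteq> {q + 1, 3 * q + 2}}. \<forall>\<^sub>F \<epsilon> in at_right 0.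
      lambda_min (L_tilde (path_laplacian n) \<epsilon> S)
        < lambda_min (L_tilde (path_laplacian n) \<epsilon> {q + 1, 3 * q + 2})"
  proof
    fix S assume "S \<in> {S. k_subset n 2 S \<and> S \<noteq> {q + 1, 3 * q + 2}}"
    then have S: "k_subset n 2 S" "S \<noteq> {q + 1, 3 * q + 2}" by auto
    obtain p1 p2 where p: "S = {p1, p2}" "1 \<le> p1" "p1 < p2" "p2 \<le> n"
      using S(1) by (elim k_subset_2_cases)
    then have pn: "p1 \<in> {1..n}" "p2 \<in> {1..n}" "p1 \<noteq> p2" by auto
    have rn: "q + 1 \<in> {1..n}" "3 * q + 2 \<in> {1..n}" "q + 1 \<noteq> 3 * q + 2" using n by auto
    have "pair_energy n (q + 1) (3 * q + 2) < pair_energy n p1 p2"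
      using pair_energy_optimal_strict[OF n pn(1,2)] S(2) p(1) by blast
    then show "\<forall>\<^sub>F \<epsilon> in at_right 0. lambda_min (L_tilde (path_laplacian n) \<epsilon> S)
        < lambda_min (L_tilde (path_laplacian n) \<epsilon> {q + 1, 3 * q + 2})"
      unfolding p(1) L_tilde_eq_L_two[OF pn] L_tilde_eq_L_two[OF rn]
      using eventually_lambda_min_L_two_less[OF _ pn(1,2) rn(1,2)] n by simp
  qed
qed

lemma MPLSE_centers_path:
  assumes n: "n = 4 * q + 2"
  shows "\<forall>\<^sub>F \<epsilon> in at_right 0. \<forall>S. MPLSE_centers (path_laplacian n) 2 \<epsilon> S \<longleftrightarrow> S = {q + 1, 3 * q + 2}"
  using eventually_optimal_pair[OF n]
proof eventually_elim
  case (elim \<epsilon>)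
  then show ?case unfolding MPLSE_centers_def path_laplacian_dim
    by (intro allI is_arg_max_iff_strict[where P = "k_subset n 2", OF optimal_pair_k_subset[OF n]]) auto
qed

text \<open>With E the sum of the marked diagonal units, I - \<tau> L + \<epsilon> E equals I -
  \<tau> (L - (\<epsilon>/\<tau>) E). So MSup-LE at \<epsilon> is MPLSE at
  \<epsilon>/\<tau>.\<close>

lemma lambda_max_Z_tilde:
  assumes n: "0 < n" and S: "k_subset n 2 S" and \<tau>: "0 < \<tau>"
  shows "lambda_max (Z_tilde (Z_mat \<tau> (path_laplacian n)) \<epsilon> S)
    = 1 - \<tau> * lambda_min (L_tilde (path_laplacian n) (\<epsilon> / \<tau>) S)"
proof -
  obtain p1 p2 where "S = {p1, p2}" "1 \<le> p1" "p1 < p2" "p2 \<le> n"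
    using S by (elim k_subset_2_cases)
  then have p: "S = {p1, p2}" "p1 \<in> {1..n}" "p2 \<in> {1..n}" "p1 \<noteq> p2" by auto
  have eq: "Z_tilde (Z_mat \<tau> (path_laplacian n)) \<epsilon> S
      = 1\<^sub>m n - \<tau> \<cdot>\<^sub>m L_tilde (path_laplacian n) (\<epsilon> / \<tau>) S"
    by (rule eq_matI)
       (use \<tau> in \<open>auto simp: Z_tilde_def Z_mat_def L_tilde_def sum_eeT_def algebra_simps\<close>)
  obtain k where "eigenvalue (L_tilde (path_laplacian n) (\<epsilon> / \<tau>) S) k"
    unfolding p(1) L_tilde_eq_L_two[OF p(2-4)] L_two_eq_jacobi[OF p(2,3)]
    using path_jacobi_eigenvalue_exists[OF n] by blast
  moreover have "L_tilde (path_laplacian n) (\<epsilon> / \<tau>) S \<in> carrier_mat n n"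
    by (rule carrier_matI) (simp_all add: L_tilde_def sum_eeT_def)
  ultimately show ?thesis unfolding eq using \<tau> by (intro lambda_max_one_minus_smult)
qed

lemma MSup_LE_centers_path:
  assumes n: "n = 4 * q + 2" and \<tau>: "0 < \<tau>"
  shows "\<forall>\<^sub>F \<epsilon> in at_right 0. \<forall>S.
    MSup_LE_centers (Z_mat \<tau> (path_laplacian n)) 2 \<epsilon> S \<longleftrightarrow> S = {q + 1, 3 * q + 2}"
proof -
  have dim: "dim_row (Z_mat \<tau> (path_laplacian n)) = n" by (simp add: Z_mat_def)
  have n0: "0 < n" using n by simp
  obtain b where b: "0 < b" "\<And>\<delta> S. 0 < \<delta> \<Longrightarrow> \<delta> < b \<Longrightarrow> k_subset n 2 S \<Longrightarrow> S \<noteq> {q + 1, 3 * q + 2} \<Longrightarrow>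
      lambda_min (L_tilde (path_laplacian n) \<delta> S)
        < lambda_min (L_tilde (path_laplacian n) \<delta> {q + 1, 3 * q + 2})"
    using eventually_optimal_pair[OF n] unfolding eventually_at_right_field by auto
  have "\<forall>S. MSup_LE_centers (Z_mat \<tau> (path_laplacian n)) 2 \<epsilon> S \<longleftrightarrow> S = {q + 1, 3 * q + 2}"
    if e: "0 < \<epsilon>" "\<epsilon> < b * \<tau>" for \<epsilon>
    unfolding MSup_LE_centers_def dim
  proof (intro allI is_arg_min_iff_strict[where P = "k_subset n 2", OF optimal_pair_k_subset[OF n]])
    fix S assume S: "k_subset n 2 S" "S \<noteq> {q + 1, 3 * q + 2}"
    have "0 < \<epsilon> / \<tau>" "\<epsilon> / \<tau> < b" using e \<tau> by (simp_all add: pos_divide_less_eq)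
    then show "lambda_max (Z_tilde (Z_mat \<tau> (path_laplacian n)) \<epsilon> {q + 1, 3 * q + 2})
        < lambda_max (Z_tilde (Z_mat \<tau> (path_laplacian n)) \<epsilon> S)"
      unfolding lambda_max_Z_tilde[OF n0 S(1) \<tau>] lambda_max_Z_tilde[OF n0 optimal_pair_k_subset[OF n] \<tau>]
      using b(2)[OF _ _ S] \<tau> by simp
  qed
  then show ?thesis unfolding eventually_at_right_field using b(1) \<tau>
    by (intro exI[of _ "b * \<tau>"]) auto
qed

lemma second_order_expansion_L_two:
  assumes n: "2 \<le> n" and p: "p1 \<in> {1..n}" "p2 \<in> {1..n}"
  shows "second_order_expansion (\<lambda>\<epsilon>. lambda_min (L_two n \<epsilon> p1 p2))
    [:0, 2 / real n, - (pair_energy n p1 p2 / real n):]"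
proof -
  let ?q = "[:0, 2 / real n, - (pair_energy n p1 p2 / real n):]"
  obtain C h where h: "0 < h" and C: "\<And>t. \<bar>t\<bar> \<le> h \<Longrightarrow> \<bar>lambda_min (L_two n t p1 p2)
      - (2 / real n * t - pair_energy n p1 p2 / real n * t\<^sup>2)\<bar> \<le> C * \<bar>t\<bar> ^ 3"
    using lambda_min_L_two_expansion[OF n p] by blast
  have poly: "poly ?q t = 2 / real n * t - pair_energy n p1 p2 / real n * t\<^sup>2" for t
    by (simp add: algebra_simps power2_eq_square)
  have "\<forall>\<^sub>F t in at_right 0. norm (lambda_min (L_two n t p1 p2) - poly ?q t) \<le> C * norm (t ^ 3)"
    unfolding eventually_at_right_field poly
  proof (intro exI[of _ h] conjI allI impI)
    fix t assume "0 < t" "t < h"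
    then show "norm (lambda_min (L_two n t p1 p2)
        - (2 / real n * t - pair_energy n p1 p2 / real n * t\<^sup>2)) \<le> C * norm (t ^ 3)"
      using C[of t] by (simp only: real_norm_def power_abs abs_of_pos less_imp_le)
  qed (rule h)
  then have "(\<lambda>t. lambda_min (L_two n t p1 p2) - poly ?q t) \<in> O[at_right 0](\<lambda>t. t ^ 3)"
    by (rule bigoI)
  moreover have "degree ?q \<le> 2" by (simp add: degree_pCons_eq_if)
  ultimately show ?thesis unfolding second_order_expansion_def by blast
qed

theorem theorem2:
  fixes n p1s p2s :: nat and \<tau> :: real
  assumes "even n" and "odd (n div 2)"
    and "0 < \<tau>" and "\<tau> < 1 / 2"
    and "p1s = (n + 2) div 4" and "p2s = (3 * n + 2) div 4"
  shows
    "(\<exists>Q :: nat \<Rightarrow> nat \<Rightarrow> real poly.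
        (\<forall>p1\<in>{1..n}. \<forall>p2\<in>{1..n}.
           second_order_expansion (\<lambda>\<epsilon>. lambda_min (L_two n \<epsilon> p1 p2)) (Q p1 p2)) \<and>
        (\<forall>\<epsilon>>0.
           (\<forall>p1\<in>{1..n}. \<forall>p2\<in>{1..n}. poly (Q p1 p2) \<epsilon> \<le> poly (Q p1s p2s) \<epsilon>) \<and>
           poly (Q p1s p2s) \<epsilon> =
             2 * \<epsilon> / real n - \<epsilon>\<^sup>2 / (12 * (real n)\<^sup>2) * ((real n)\<^sup>2 - 4) \<and>
           2 * \<epsilon> / real n - \<epsilon>\<^sup>2 / (12 * (real n)\<^sup>2) * ((real n)\<^sup>2 - 4) =
             2 * \<epsilon> / real n - \<epsilon>\<^sup>2 / (4 * real n) *
               (\<Sum>j=2..n. (cos (pi * (real j - 1) / 4) + cos (3 * pi * (real j - 1) / 4))\<^sup>2 /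
                  ((sin (pi * (real j - 1) / (2 * real n)))\<^sup>2 *
                   (\<Sum>p=1..n. (cos (pi * (real j - 1) * (real p - 1 / 2) / real n))\<^sup>2))))) \<and>
     (2 < n \<longrightarrow>
        (\<forall>\<^sub>F \<epsilon> in at_right 0. \<forall>S. MPLSE_centers (path_laplacian n) 2 \<epsilon> S \<longleftrightarrow> S = {p1s, p2s}) \<and>
        (\<forall>S. MSub_LE_centers (Z_mat \<tau> (path_laplacian n)) 2 S \<longleftrightarrow> S = {p1s, p2s}) \<and>
        (\<forall>\<^sub>F \<epsilon> in at_right 0.
           \<forall>S. MSup_LE_centers (Z_mat \<tau> (path_laplacian n)) 2 \<epsilon> S \<longleftrightarrow> S = {p1s, p2s})) \<and>
     (2 < n \<longrightarrow>
        (\<forall>v3. eigenvector (path_laplacian n) v3 (kth_smallest_eigenvalue (path_laplacian n) 3) \<longrightarrow>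
           (\<forall>j\<in>{1..n}. v3 $ (j - 1) = 0 \<longleftrightarrow> j \<in> {p1s, p2s})))"
proof -
  define q where "q = n div 4"
  have n: "n = 4 * q + 2" using assms(1,2) unfolding q_def by presburger
  \<comment> \<open>Both divisions are exact: n + 2 = 4(q + 1) and 3n + 2 = 4(3q + 2).\<close>
  have p: "p1s = q + 1" "p2s = 3 * q + 2" using assms(5,6) n by simp_all
  have n2: "2 \<le> n" and n0: "0 < real n" using n by auto
  define Q where "Q p1 p2 = [:0, 2 / real n, - (pair_energy n p1 p2 / real n):]" for p1 p2
  have Q: "poly (Q p1 p2) \<epsilon> = 2 / real n * \<epsilon> - pair_energy n p1 p2 / real n * \<epsilon>\<^sup>2" for p1 p2 \<epsilon>
    by (simp add: Q_def algebra_simps power2_eq_square)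
  have opt: "poly (Q p1 p2) \<epsilon> \<le> poly (Q p1s p2s) \<epsilon>" for p1 p2 \<epsilon>
    using pair_energy_optimal[OF n, of p1 p2] n0 unfolding Q p
    by (simp add: divide_right_mono mult_right_mono)
  have val: "poly (Q p1s p2s) \<epsilon> = 2 * \<epsilon> / real n - \<epsilon>\<^sup>2 / (12 * (real n)\<^sup>2) * ((real n)\<^sup>2 - 4)" for \<epsilon>
    unfolding Q p pair_energy_optimal_value[OF n] using n0 by (simp add: field_simps power2_eq_square)
  have trig: "\<epsilon>\<^sup>2 / (12 * (real n)\<^sup>2) * ((real n)\<^sup>2 - 4)
      = \<epsilon>\<^sup>2 / (4 * real n) * (((real n)\<^sup>2 - 4) / (3 * real n))" for \<epsilon>
    by (simp add: power2_eq_square)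
  have third: "v $ (j - 1) = 0 \<longleftrightarrow> j \<in> {p1s, p2s}"
    if "2 < n" "eigenvector (path_laplacian n) v (kth_smallest_eigenvalue (path_laplacian n) 3)"
      "j \<in> {1..n}" for v j
  proof -
    have "j - 1 < n" "j - 1 = q \<longleftrightarrow> j = q + 1" "j - 1 = 3 * q + 1 \<longleftrightarrow> j = 3 * q + 2"
      using that(3) by auto
    then show ?thesis using third_eigenvector_zero_iff[OF n that(1,2)] unfolding p by simp
  qed
  have exp: "\<forall>p1\<in>{1..n}. \<forall>p2\<in>{1..n}.
      second_order_expansion (\<lambda>\<epsilon>. lambda_min (L_two n \<epsilon> p1 p2)) (Q p1 p2)"
    unfolding Q_def by (intro ballI second_order_expansion_L_two[OF n2])
  show ?thesis
    unfolding trig_sum_eq[OF n]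
  proof (intro conjI exI[of _ Q] impI ballI allI)
    show "\<forall>\<^sub>F \<epsilon> in at_right 0. \<forall>S. MPLSE_centers (path_laplacian n) 2 \<epsilon> S \<longleftrightarrow> S = {p1s, p2s}"
      unfolding p by (rule MPLSE_centers_path[OF n])
    show "\<forall>\<^sub>F \<epsilon> in at_right 0. \<forall>S.
        MSup_LE_centers (Z_mat \<tau> (path_laplacian n)) 2 \<epsilon> S \<longleftrightarrow> S = {p1s, p2s}"
      unfolding p by (rule MSup_LE_centers_path[OF n assms(3)])
    show "MSub_LE_centers (Z_mat \<tau> (path_laplacian n)) 2 S \<longleftrightarrow> S = {p1s, p2s}" if "2 < n" for S
      unfolding p by (rule MSub_LE_centers_path[OF n that assms(3)])
  qed (use exp in blast, rule opt, rule val, simp only: trig, rule third)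
qed

end
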